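(* Let $0<\varepsilon<1/3$. There exist constants $c,c'>0$ depending only on $\varepsilon$ such that for all $d\ge3$ and all $x\in\mathbb{H}=\{0,1\}^d$, \[ \mathbb{P}\big[\text{some neighbour of }x\text{ is contained in a substantial component of }\mathbb{H}\cap E_\varphi^{\ge h_{\mathrm{as}}(d)(1-2\varepsilon)}\big]\ge1-ce^{-c'd^\varepsilon}. \]
   Context: Under $\mathbb{P}$, $\varphi$ is the Gaussian free field on $\mathbb{Z}^d$ ($d\ge3$): centered Gaussian with covariance the Green function $g(x,y)=\sum_{n\ge0}P_x[X_n=y]$ of simple random walk; $h_{\mathrm{as}}(d)=\sqrt{2g(0,0)\log d}$ and $E_\varphi^{\ge h}=\{x:\varphi_x\ge h\}$. Neighbours are with respect to the nearest-neighbour graph ($|y-x|_1=1$). Let $b=b(\varepsilon)=1+11/\varepsilon$. For $K\subset\mathbb{Z}^d$, a substantial component of $K$ is a (nearest-neighbour) connected subset $C$ of $K$ containing at least $\lfloor d^\varepsilon/b\rfloor^{b-1}$ points. *)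

theory Defs
  imports "HOL-Probability.Probability"
begin

text \<open>Points of the lattice Z^d are integer lists of length d.\<close>

definition lattice :: "nat \<Rightarrow> int list set" where
  "lattice d = {x. length x = d}"

text \<open>The hypercube {0,1}^d inside Z^d.\<close>
definition hypercube :: "nat \<Rightarrow> int list set" where
  "hypercube d = {x. length x = d \<and> set x \<subseteq> {0, 1}}"

text \<open>Nearest-neighbour relation: l1-distance exactly 1.\<close>
definition nbr :: "int list \<Rightarrow> int list \<Rightarrow> bool" where
  "nbr x y \<longleftrightarrow> length x = length y \<and> (\<Sum>i<length x. \<bar>y ! i - x ! i\<bar>) = 1"

text \<open>n-step transition probability of simple random walk on Z^(length x).\<close>
fun srw_prob :: "nat \<Rightarrow> int list \<Rightarrow> int list \<Rightarrow> real" where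
  "srw_prob 0 x y = (if x = y then 1 else 0)"
| "srw_prob (Suc n) x y = (\<Sum>z\<in>{z. nbr x z}. srw_prob n z y) / (2 * real (length x))"

text \<open>Green function g(x,y) = sum over n of P_x[X_n = y].\<close>
definition green :: "int list \<Rightarrow> int list \<Rightarrow> real" where
  "green x y = (\<Sum>n. srw_prob n x y)"

definition origin :: "nat \<Rightarrow> int list" where
  "origin d = replicate d 0"

text \<open>h_as(d) = sqrt(2 g(0,0) log d).\<close>
definition h_as :: "nat \<Rightarrow> real" where
  "h_as d = sqrt (2 * green (origin d) (origin d) * ln (real d))"

text \<open>Nearest-neighbour connectedness of a set of lattice points.\<close>
definition nn_connected :: "int list set \<Rightarrow> bool" where
  "nn_connected C \<longleftrightarrow>
     (\<forall>x\<in>C. \<forall>y\<in>C. (x, y) \<in> {(u, v). u \<in> C \<and> v \<in> C \<and> nbr u v}\<^sup>*)"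

text \<open>b(eps) = 1 + 11/eps and substantial components.\<close>
definition bconst :: "real \<Rightarrow> real" where
  "bconst \<epsilon> = 1 + 11 / \<epsilon>"

definition substantial_comp :: "real \<Rightarrow> nat \<Rightarrow> int list set \<Rightarrow> int list set \<Rightarrow> bool" where
  "substantial_comp \<epsilon> d K C \<longleftrightarrow> C \<subseteq> K \<and> nn_connected C \<and>
     real (card C) \<ge> real_of_int \<lfloor>real d powr \<epsilon> / bconst \<epsilon>\<rfloor> powr (bconst \<epsilon> - 1)"

text \<open>Level set E^{>= h} of a field configuration.\<close>
definition level_set :: "(int list \<Rightarrow> real) \<Rightarrow> nat \<Rightarrow> real \<Rightarrow> int list set" where
  "level_set \<omega> d h = {x \<in> lattice d. \<omega> x \<ge> h}"

text \<open>P is the law of the Gaussian free field on Z^d, realised canonically on the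
  configuration space int list => real (coordinates outside Z^d are irrelevant):
  the coordinate process restricted to Z^d is a centred Gaussian process with
  covariance the Green function, expressed through characteristic functions of
  all finite linear combinations.\<close>
definition gff_law :: "nat \<Rightarrow> (int list \<Rightarrow> real) measure \<Rightarrow> bool" where
  "gff_law d P \<longleftrightarrow> prob_space P \<and> sets P = sets (Pi\<^sub>M UNIV (\<lambda>_. borel)) \<and>
     (\<forall>S a. finite S \<and> S \<subseteq> lattice d \<longrightarrow>
        (LINT \<omega>|P. iexp (\<Sum>x\<in>S. a x * \<omega> x))
          = complex_of_real (exp (- (\<Sum>x\<in>S. \<Sum>y\<in>S. a x * a y * green x y) / 2)))"

end

theory Submission
  imports Defs "HOL-Real_Asymp.Real_Asymp"
begin

text \<open>
  The function \<open>a (a + 1) / (|x - y|\<^sup>2 + a)\<close> with \<open>a = 1 / (d - 1)\<close> is a supersolution of the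
  Poisson equation with source at \<open>y\<close>, so the Green function is at most \<open>1 + a\<close> on the diagonal
  and at most \<open>a\<close> off it. The field at the cube neighbours of a cube vertex is an exchangeable
  Gaussian vector by symmetry; subtracting a suitable multiple of its sum leaves independent
  variables of variance close to 1, while the subtracted term has variance at most \<open>a\<close>.

  Let \<open>s = \<lfloor>d\<^sup>\<epsilon> / b\<rfloor>\<close> and \<open>m = \<lceil>11 / \<epsilon>\<rceil>\<close>, and cut the coordinates into \<open>m s\<close> blocks of length of
  order \<open>d\<close> to the power \<open>1 - \<epsilon>\<close>. A value above the level has probability about \<open>d\<close> to the power
  \<open>- (1 - 2 \<epsilon>)\<^sup>2\<close>, so flipping the coordinates of one block at a given vertex never reaches the level
  with probability at most \<open>exp (- d\<^sup>\<gamma>)\<close> for some \<open>\<gamma> > \<epsilon>\<close>. A union bound over the polynomially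
  many vertices within distance \<open>m\<close> of \<open>x\<close> then yields an \<open>s\<close>-ary tree of depth \<open>m\<close> in the level
  set, rooted at a neighbour of \<open>x\<close>.
\<close>

section \<open>Bounds on the Green function\<close>

lemma nbr_length: "nbr x z \<Longrightarrow> length z = length x"
  by (simp add: nbr_def)

lemma nbr_sym: "nbr x y \<Longrightarrow> nbr y x"
  by (auto simp: nbr_def abs_minus_commute)

lemma nbr_update:
  assumes "i < length x" "\<bar>e\<bar> = 1"
  shows "nbr x (x[i := x ! i + e])"
proof -
  have "(\<Sum>k<length x. \<bar>x[i := x ! i + e] ! k - x ! k\<bar>) = (\<Sum>k<length x. if k = i then \<bar>e\<bar> else 0)"
    by (intro sum.cong) (auto simp: nth_list_update)
  also have "\<dots> = 1" using assms by simp
  finally show ?thesis by (simp add: nbr_def)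
qed

lemma nbrE:
  assumes "nbr x z"
  obtains i e where "i < length x" "\<bar>e\<bar> = 1" "z = x[i := x ! i + e]"
proof -
  have len: "length z = length x" and dist: "(\<Sum>k<length x. \<bar>z ! k - x ! k\<bar>) = 1"
    using assms by (auto simp: nbr_def)
  obtain i where i: "i < length x" "z ! i \<noteq> x ! i"
    using dist
    by (metis (mono_tags, lifting) abs_zero diff_self lessThan_iff sum.neutral zero_neq_one)
  have "(\<Sum>k<length x. \<bar>z ! k - x ! k\<bar>) = \<bar>z ! i - x ! i\<bar> + (\<Sum>k\<in>{..<length x}-{i}. \<bar>z ! k - x ! k\<bar>)"
    using i by (intro sum.remove) auto
  moreover have "(\<Sum>k\<in>{..<length x}-{i}. \<bar>z ! k - x ! k\<bar>) \<ge> 0" by (intro sum_nonneg) auto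
  moreover have "\<bar>z ! i - x ! i\<bar> \<ge> 1" using i by linarith
  ultimately have at_i: "\<bar>z ! i - x ! i\<bar> = 1"
    and rest: "(\<Sum>k\<in>{..<length x}-{i}. \<bar>z ! k - x ! k\<bar>) = 0"
    using dist by linarith+
  have "z ! k = x ! k" if "k < length x" "k \<noteq> i" for k
    using rest that by (subst (asm) sum_nonneg_eq_0_iff) auto
  then have "z = x[i := x ! i + (z ! i - x ! i)]"
    using len i by (intro nth_equalityI) (auto simp: nth_list_update)
  then show ?thesis using that i(1) at_i by blast
qed

lemma neighbours_eq_image:
  "{z. nbr x z} = (\<lambda>(i, e). x[i := x ! i + e]) ` ({..<length x} \<times> {1, -1})"
proof -
  have "\<bar>e\<bar> = 1 \<longleftrightarrow> e \<in> {1, -1}" for e :: int by auto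
  then show ?thesis by (auto intro: nbr_update elim!: nbrE)
qed

lemma sum_neighbours:
  fixes F :: "int list \<Rightarrow> 'a :: comm_monoid_add"
  shows "(\<Sum>z | nbr x z. F z) = (\<Sum>i<length x. F (x[i := x ! i + 1]) + F (x[i := x ! i - 1]))"
proof -
  have inj: "inj_on (\<lambda>(i, e). x[i := x ! i + e]) ({..<length x} \<times> {1, -1})"
  proof (rule inj_onI)
    fix p q :: "nat \<times> int"
    assume pq: "p \<in> {..<length x} \<times> {1, -1}" "q \<in> {..<length x} \<times> {1, -1}"
      and eq: "(case p of (i, e) \<Rightarrow> x[i := x ! i + e]) = (case q of (i, e) \<Rightarrow> x[i := x ! i + e])"
    have "fst p = fst q"
      using arg_cong[OF eq, of "\<lambda>l. l ! fst p"] pq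
      by (cases "fst p = fst q") (auto split: prod.splits)
    then show "p = q"
      using arg_cong[OF eq, of "\<lambda>l. l ! fst p"] pq by (auto split: prod.splits)
  qed
  show ?thesis unfolding neighbours_eq_image
    by (subst sum.reindex[OF inj]) (simp add: sum.cartesian_product' o_def case_prod_unfold)
qed

lemma srw_prob_nonneg: "0 \<le> srw_prob n x y"
  by (induction n arbitrary: x) (auto intro!: sum_nonneg divide_nonneg_nonneg)

lemma sum_srw_prob_le_supersolution:
  fixes F :: "int list \<Rightarrow> real"
  assumes F_nonneg: "\<And>x. length x = d \<Longrightarrow> 0 \<le> F x"
    and F_super: "\<And>x. length x = d \<Longrightarrow>
      (if x = y then 1 else 0) + (\<Sum>z | nbr x z. F z) / (2 * real d) \<le> F x"
    and "length x = d"
  shows "(\<Sum>n<N. srw_prob n x y) \<le> F x"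
  using \<open>length x = d\<close>
proof (induction N arbitrary: x)
  case 0
  then show ?case using F_nonneg by simp
next
  case (Suc N)
  have "(\<Sum>n<Suc N. srw_prob n x y)
      = (if x = y then 1 else 0) + (\<Sum>z | nbr x z. \<Sum>n<N. srw_prob n z y) / (2 * real d)"
    using Suc.prems
    by (subst sum.lessThan_Suc_shift)
      (simp add: sum_divide_distrib[symmetric] sum.swap[of _ _ "{..<N}"])
  also have "\<dots> \<le> (if x = y then 1 else 0) + (\<Sum>z | nbr x z. F z) / (2 * real d)"
    using Suc.prems
    by (intro add_left_mono divide_right_mono sum_mono Suc.IH) (auto dest: nbr_length)
  also have "\<dots> \<le> F x" using Suc.prems by (rule F_super)
  finally show ?case .
qed

lemma
  fixes F :: "int list \<Rightarrow> real"
  assumes "\<And>x. length x = d \<Longrightarrow> 0 \<le> F x"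
    and "\<And>x. length x = d \<Longrightarrow> (if x = y then 1 else 0) + (\<Sum>z | nbr x z. F z) / (2 * real d) \<le> F x"
    and "length x = d"
  shows summable_srw_prob_if_supersolution: "summable (\<lambda>n. srw_prob n x y)"
    and green_le_supersolution: "green x y \<le> F x"
proof -
  note bound = sum_srw_prob_le_supersolution[of d F y x, OF assms]
  show summable: "summable (\<lambda>n. srw_prob n x y)"
    using bound by (intro summableI_nonneg_bounded srw_prob_nonneg)
  show "green x y \<le> F x"
    unfolding green_def using bound summable by (intro suminf_le_const)
qed

definition sq_dist :: "int list \<Rightarrow> int list \<Rightarrow> int" where
  "sq_dist x y = (\<Sum>i<length x. (x ! i - y ! i)\<^sup>2)"

lemma sq_dist_nonneg: "0 \<le> sq_dist x y"
  by (simp add: sq_dist_def sum_nonneg)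

lemma sq_dist_self [simp]: "sq_dist x x = 0"
  by (simp add: sq_dist_def)

lemma sq_dist_ge_1:
  assumes "length x = length y" "x \<noteq> y"
  shows "1 \<le> sq_dist x y"
proof -
  obtain i where i: "i < length x" "x ! i \<noteq> y ! i" using assms nth_equalityI by blast
  have "1 \<le> (x ! i - y ! i)\<^sup>2" using i by (simp add: int_one_le_iff_zero_less)
  also have "\<dots> \<le> sq_dist x y" unfolding sq_dist_def using i by (intro member_le_sum) auto
  finally show ?thesis .
qed

lemma sq_dist_update:
  assumes "i < length x"
  shows "sq_dist (x[i := x ! i + e]) y = sq_dist x y + e\<^sup>2 + 2 * e * (x ! i - y ! i)"
proof -
  have split: "sq_dist z y = (z ! i - y ! i)\<^sup>2 + (\<Sum>k\<in>{..<length x}-{i}. (z ! k - y ! k)\<^sup>2)"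
    if "length z = length x" for z
    unfolding sq_dist_def using that assms by (subst sum.remove[of _ i]) auto
  have "(\<Sum>k\<in>{..<length x}-{i}. (x[i := x ! i + e] ! k - y ! k)\<^sup>2)
      = (\<Sum>k\<in>{..<length x}-{i}. (x ! k - y ! k)\<^sup>2)"
    by (intro sum.cong) auto
  then show ?thesis using split[of x] split[of "x[i := x ! i + e]"] assms
    by (simp add: power2_eq_square algebra_simps)
qed

definition barrier :: "real \<Rightarrow> int list \<Rightarrow> int list \<Rightarrow> real" where
  "barrier a y x = a * (a + 1) / (real_of_int (sq_dist x y) + a)"

lemma barrier_nonneg: "a > 0 \<Longrightarrow> 0 \<le> barrier a y x"
  using sq_dist_nonneg[of x y] by (simp add: barrier_def)

lemma four_mult_less_square:
  fixes N a :: real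
  assumes "0 \<le> N" "0 < a"
  shows "4 * N < (N + a + 1)\<^sup>2"
proof -
  have "(N + a + 1)\<^sup>2 = 4 * N + ((N - 1)\<^sup>2 + a * (2 * N + 2) + a\<^sup>2)"
    by (simp add: power2_eq_square algebra_simps)
  moreover have "0 < (N - 1)\<^sup>2 + a * (2 * N + 2) + a\<^sup>2"
    using assms by (intro add_nonneg_pos add_pos_pos) auto
  ultimately show ?thesis by linarith
qed

text \<open>The chord of the convex function \<open>s \<mapsto> A / (A\<^sup>2 - s)\<close> over \<open>[0, M]\<close>. It makes points on a
  coordinate axis the worst case for superharmonicity of the barrier.\<close>

lemma chord_bound:
  fixes A s M :: real
  assumes "A > 0" "0 \<le> s" "s \<le> M" "M < A\<^sup>2"
  shows "A / (A\<^sup>2 - s) \<le> 1 / A + s / (A * (A\<^sup>2 - M))"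
proof -
  have "A / (A\<^sup>2 - s) = 1 / A + s / (A * (A\<^sup>2 - s))"
    using assms by (simp add: field_simps power2_eq_square)
  also have "s / (A * (A\<^sup>2 - s)) \<le> s / (A * (A\<^sup>2 - M))"
    using assms by (intro divide_left_mono mult_left_mono mult_pos_pos) auto
  finally show ?thesis by simp
qed

lemma barrier_opposite_neighbours:
  assumes "i < length x" "a > 0" and "A = real_of_int (sq_dist x y) + a + 1"
  shows "barrier a y (x[i := x ! i + 1]) + barrier a y (x[i := x ! i - 1])
    = 2 * (a * (a + 1)) * (A / (A\<^sup>2 - 4 * (real_of_int (x ! i - y ! i))\<^sup>2))"
proof -
  define t where "t = real_of_int (x ! i - y ! i)"
  have up: "real_of_int (sq_dist (x[i := x ! i + 1]) y) + a = A + 2 * t"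
    using sq_dist_update[of i x 1 y] assms by (simp add: t_def)
  have down: "real_of_int (sq_dist (x[i := x ! i - 1]) y) + a = A - 2 * t"
    using sq_dist_update[of i x "-1" y] assms by (simp add: t_def)
  have "A + 2 * t > 0" "A - 2 * t > 0"
    using sq_dist_nonneg[of "x[i := x ! i + 1]" y] sq_dist_nonneg[of "x[i := x ! i - 1]" y] \<open>a > 0\<close>
    unfolding up[symmetric] down[symmetric] by linarith+
  moreover have "A\<^sup>2 - 4 * t\<^sup>2 = (A + 2 * t) * (A - 2 * t)"
    by (simp add: power2_eq_square algebra_simps)
  ultimately show ?thesis unfolding barrier_def up down t_def[symmetric]
    by (simp add: field_simps)
qed

lemma barrier_average_le:
  assumes "length x = d" "d > 0" "a > 0"
    and N: "N = real_of_int (sq_dist x y)" and A: "A = N + a + 1"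
  shows "(\<Sum>z | nbr x z. barrier a y z) / (2 * real d)
    \<le> a * (a + 1) * (1 / A + 4 * N / (d * (A * (A\<^sup>2 - 4 * N))))"
proof -
  define s where "s i = 4 * (real_of_int (x ! i - y ! i))\<^sup>2" for i
  have N_nonneg: "N \<ge> 0" using sq_dist_nonneg[of x y] by (simp add: N)
  then have A_pos: "A > 0" using assms by simp
  have sum_s: "(\<Sum>i<d. s i) = 4 * N"
    using assms by (simp add: s_def sq_dist_def sum_distrib_left)
  have s_le: "s i \<le> 4 * N" if "i < d" for i
    unfolding sum_s[symmetric] using that by (intro member_le_sum) (auto simp: s_def)
  have "(\<Sum>z | nbr x z. barrier a y z) = (\<Sum>i<d. 2 * (a * (a + 1)) * (A / (A\<^sup>2 - s i)))"
    using assms barrier_opposite_neighbours[of _ x a A y] by (simp add: sum_neighbours s_def)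
  also have "\<dots> = 2 * (a * (a + 1)) * (\<Sum>i<d. A / (A\<^sup>2 - s i))"
    by (simp add: sum_distrib_left)
  also have "(\<Sum>i<d. A / (A\<^sup>2 - s i)) \<le> (\<Sum>i<d. 1 / A + s i / (A * (A\<^sup>2 - 4 * N)))"
    using A_pos s_le four_mult_less_square[OF N_nonneg \<open>a > 0\<close>]
    by (intro sum_mono chord_bound) (auto simp: s_def A)
  also have "\<dots> = d * (1 / A + 4 * N / (d * (A * (A\<^sup>2 - 4 * N))))"
    using \<open>d > 0\<close> by (simp add: sum.distrib sum_divide_distrib[symmetric] sum_s distrib_left)
  finally have "(\<Sum>z | nbr x z. barrier a y z)
      \<le> 2 * (a * (a + 1)) * (d * (1 / A + 4 * N / (d * (A * (A\<^sup>2 - 4 * N)))))"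
    using \<open>a > 0\<close> by simp
  then have "(\<Sum>z | nbr x z. barrier a y z) / (2 * real d)
      \<le> 2 * (a * (a + 1)) * (d * (1 / A + 4 * N / (d * (A * (A\<^sup>2 - 4 * N))))) / (2 * real d)"
    by (rule divide_right_mono) simp
  then show ?thesis using \<open>d > 0\<close> by simp
qed

lemma barrier_coefficient_bound:
  fixes N a d :: real
  assumes "d \<ge> 25" and "a = 1 / (d - 1)" and "N = 1 \<or> N \<ge> 2"
  shows "(N + a) * (4 * N) \<le> d * ((N + a + 1)\<^sup>2 - 4 * N)"
  using \<open>N = 1 \<or> N \<ge> 2\<close>
proof
  assume "N = 1"
  have "a > 0" using assms by simp
  have "a * d = 1 + a" using assms by (simp add: field_simps)
  then have "d * ((N + a + 1)\<^sup>2 - 4 * N) = (1 + a) * (a + 4)"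
    using \<open>N = 1\<close> by (simp add: power2_eq_square algebra_simps)
  moreover have "(1 + a) * 4 \<le> (1 + a) * (a + 4)" using \<open>a > 0\<close> by (intro mult_left_mono) auto
  ultimately show ?thesis using \<open>N = 1\<close> by (simp add: algebra_simps)
next
  assume "N \<ge> 2"
  have a_bounds: "0 < a" "a \<le> 1" using assms by auto
  have "(N + a) * (4 * N) \<le> (N + 1) * (4 * N)"
    using a_bounds \<open>N \<ge> 2\<close> by (intro mult_right_mono) auto
  also have "\<dots> \<le> 24 * (N - 1)\<^sup>2"
  proof -
    have "24 * (N - 1)\<^sup>2 - (N + 1) * (4 * N) = (N - 2) * (20 * N - 12)"
      by (simp add: power2_eq_square algebra_simps)
    moreover have "(N - 2) * (20 * N - 12) \<ge> 0" using \<open>N \<ge> 2\<close> by (intro mult_nonneg_nonneg) auto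
    ultimately show ?thesis by linarith
  qed
  also have "\<dots> \<le> d * ((N + a + 1)\<^sup>2 - 4 * N)"
  proof (rule mult_mono)
    have "(N + a + 1)\<^sup>2 - 4 * N = (N - 1)\<^sup>2 + (a * (2 * N + 2) + a\<^sup>2)"
      by (simp add: power2_eq_square algebra_simps)
    then show "(N - 1)\<^sup>2 \<le> (N + a + 1)\<^sup>2 - 4 * N" using a_bounds \<open>N \<ge> 2\<close> by simp
  qed (use \<open>d \<ge> 25\<close> in auto)
  finally show ?thesis .
qed

lemma barrier_radial_superharmonic:
  fixes N a d :: real
  assumes d: "d \<ge> 25" and a: "a = 1 / (d - 1)" and N: "N = 1 \<or> N \<ge> 2" and A: "A = N + a + 1"
  shows "1 / A + 4 * N / (d * (A * (A\<^sup>2 - 4 * N))) \<le> 1 / (N + a)"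
proof -
  define D where "D = A\<^sup>2 - 4 * N"
  have "a > 0" "N > 0" using d a N by auto
  then have pos: "a > 0" "N > 0" "A > 0" by (simp_all add: A)
  have "D > 0" using four_mult_less_square[of N a] pos by (simp add: D_def A)
  have "4 * N / (d * (A * D)) = (N + a) * (4 * N) / (d * D) * (1 / ((N + a) * A))"
    using pos by simp
  also have "\<dots> \<le> 1 * (1 / ((N + a) * A))"
    using barrier_coefficient_bound[OF d a N] pos d \<open>D > 0\<close>
    by (intro mult_right_mono) (simp_all add: D_def A)
  also have "\<dots> = 1 / (N + a) - 1 / A" using pos by (simp add: A field_simps)
  finally show ?thesis by (simp add: D_def)
qed

lemma barrier_superharmonic:
  assumes len: "length x = d" "length y = d" and d: "d \<ge> 25" and a: "a = 1 / (real d - 1)"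
  shows "(if x = y then 1 else 0) + (\<Sum>z | nbr x z. barrier a y z) / (2 * real d) \<le> barrier a y x"
proof -
  define N where "N = real_of_int (sq_dist x y)"
  define A where "A = N + a + 1"
  have "a > 0" using d a by simp
  then have average: "(\<Sum>z | nbr x z. barrier a y z) / (2 * real d)
      \<le> a * (a + 1) * (1 / A + 4 * N / (d * (A * (A\<^sup>2 - 4 * N))))"
    using len d by (intro barrier_average_le) (auto simp: N_def A_def)
  show ?thesis
  proof (cases "x = y")
    case True
    then have "N = 0" by (simp add: N_def)
    moreover have "1 + a * (a + 1) * (1 / (a + 1)) = a * (a + 1) / a"
      using \<open>a > 0\<close> by (simp add: field_simps)
    ultimately show ?thesis using average True by (simp add: A_def barrier_def)
  next
    case False
    then have "sq_dist x y = 1 \<or> sq_dist x y \<ge> 2" using len sq_dist_ge_1[of x y] by force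
    then have "N = 1 \<or> N \<ge> 2" unfolding N_def by auto
    then have "a * (a + 1) * (1 / A + 4 * N / (d * (A * (A\<^sup>2 - 4 * N))))
        \<le> a * (a + 1) * (1 / (N + a))"
      using d a \<open>a > 0\<close> by (intro mult_left_mono barrier_radial_superharmonic) (auto simp: A_def)
    then show ?thesis using average False by (simp add: barrier_def N_def)
  qed
qed

lemma
  assumes "length x = d" "length y = d" "d \<ge> 25"
  shows summable_srw_prob: "summable (\<lambda>n. srw_prob n x y)"
    and green_le_barrier: "green x y \<le> barrier (1 / (real d - 1)) y x"
  using summable_srw_prob_if_supersolution[of d "barrier (1 / (real d - 1)) y" y x]
    green_le_supersolution[of d "barrier (1 / (real d - 1)) y" y x]
    barrier_superharmonic[of _ d y] barrier_nonneg[of "1 / (real d - 1)" y] assms by simp_all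

lemma green_nonneg:
  assumes "length x = d" "length y = d" "d \<ge> 25"
  shows "0 \<le> green x y"
  unfolding green_def using summable_srw_prob[OF assms] by (intro suminf_nonneg srw_prob_nonneg)

lemma green_diag_ge_1:
  assumes "length x = d" "d \<ge> 25"
  shows "1 \<le> green x x"
  unfolding green_def
  using sum_le_suminf[OF summable_srw_prob[of x d x], of "{0}"] assms srw_prob_nonneg by simp

lemma green_diag_le:
  assumes "length x = d" "d \<ge> 25"
  shows "green x x \<le> 1 + 1 / (real d - 1)"
  using green_le_barrier[of x d x] assms by (simp add: barrier_def)

lemma green_off_diag_le:
  assumes "length x = d" "length y = d" "d \<ge> 25" "x \<noteq> y"
  shows "green x y \<le> 1 / (real d - 1)"
proof -
  define a where "a = 1 / (real d - 1)"
  have a: "a > 0" using assms by (simp add: a_def)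
  have N: "1 \<le> real_of_int (sq_dist x y)" using sq_dist_ge_1[of x y] assms by simp
  have "green x y \<le> barrier a y x" using green_le_barrier[OF assms(1-3)] by (simp add: a_def)
  also have "\<dots> \<le> a * (a + 1) / (1 + a)" unfolding barrier_def
    using a N by (intro divide_left_mono mult_pos_pos) auto
  also have "\<dots> = a" using a by (simp add: field_simps)
  finally show ?thesis by (simp add: a_def)
qed

section \<open>Symmetries of the Green function\<close>

lemma green_automorphism:
  assumes bij: "bij_betw T (lattice d) (lattice d)"
    and nbr_iff: "\<And>x y. x \<in> lattice d \<Longrightarrow> y \<in> lattice d \<Longrightarrow> nbr (T x) (T y) \<longleftrightarrow> nbr x y"
    and xy: "x \<in> lattice d" "y \<in> lattice d"
  shows "green (T x) (T y) = green x y"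
proof -
  have length_T: "length (T x) = d" if "x \<in> lattice d" for x
    using bij_betwE[OF bij] that by (auto simp: lattice_def)
  have inj: "inj_on T (lattice d)" using bij by (rule bij_betw_imp_inj_on)
  have "srw_prob n (T x) (T y) = srw_prob n x y" if "x \<in> lattice d" for n x
    using that
  proof (induction n arbitrary: x)
    case 0
    then show ?case using inj_onD[OF inj] \<open>y \<in> lattice d\<close> by auto
  next
    case (Suc n)
    have sub: "{z. nbr x z} \<subseteq> lattice d"
      using Suc.prems by (auto simp: lattice_def dest: nbr_length)
    have "T ` {z. nbr x z} = {z. nbr (T x) z}"
    proof (intro set_eqI iffI)
      fix z assume "z \<in> {z. nbr (T x) z}"
      then have "z \<in> lattice d" using length_T[OF Suc.prems]
        by (auto simp: lattice_def dest: nbr_length)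
      then obtain w where "w \<in> lattice d" "z = T w" using bij by (auto simp: bij_betw_def)
      then show "z \<in> T ` {z. nbr x z}" using nbr_iff Suc.prems \<open>z \<in> {z. nbr (T x) z}\<close> by auto
    qed (use nbr_iff Suc.prems sub in auto)
    then have "bij_betw T {z. nbr x z} {z. nbr (T x) z}"
      using inj_on_subset[OF inj sub] by (simp add: bij_betw_def)
    then have "(\<Sum>z | nbr (T x) z. srw_prob n z (T y)) = (\<Sum>z | nbr x z. srw_prob n (T z) (T y))"
      by (rule sum.reindex_bij_betw[symmetric])
    also have "\<dots> = (\<Sum>z | nbr x z. srw_prob n z y)"
      using Suc.IH sub by (intro sum.cong) auto
    finally show ?case using Suc.prems length_T[OF Suc.prems] by (simp add: lattice_def)
  qed
  then show ?thesis using xy by (simp add: green_def)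
qed

definition lattice_isometry :: "(nat \<Rightarrow> int) \<Rightarrow> (nat \<Rightarrow> nat) \<Rightarrow> int list \<Rightarrow> int list \<Rightarrow> int list" where
  "lattice_isometry \<sigma> \<pi> v x = map (\<lambda>l. \<sigma> l * (x ! \<pi> l - v ! \<pi> l)) [0..<length x]"

lemma length_lattice_isometry [simp]: "length (lattice_isometry \<sigma> \<pi> v x) = length x"
  by (simp add: lattice_isometry_def)

lemma nth_lattice_isometry [simp]:
  "l < length x \<Longrightarrow> lattice_isometry \<sigma> \<pi> v x ! l = \<sigma> l * (x ! \<pi> l - v ! \<pi> l)"
  by (simp add: lattice_isometry_def)

lemma green_lattice_isometry:
  assumes \<pi>: "\<pi> permutes {..<d}" and \<sigma>: "\<And>l. l < d \<Longrightarrow> \<bar>\<sigma> l\<bar> = 1"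
    and xy: "length x = d" "length y = d"
  shows "green (lattice_isometry \<sigma> \<pi> v x) (lattice_isometry \<sigma> \<pi> v y) = green x y"
proof (rule green_automorphism)
  let ?T = "lattice_isometry \<sigma> \<pi> v"
  define S where "S y = map (\<lambda>k. \<sigma> (inv \<pi> k) * y ! inv \<pi> k + v ! k) [0..<d]" for y
  have \<pi>_less: "\<pi> l < d" "inv \<pi> l < d" if "l < d" for l
    using that permutes_in_image[OF \<pi>, of l] permutes_in_image[OF permutes_inv[OF \<pi>], of l] by auto
  have \<sigma>_sq: "\<sigma> l * (\<sigma> l * z) = z" if "l < d" for l z
    using \<sigma>[OF that] by (auto simp: abs_if split: if_splits)
  have "S (?T x) = x" "?T (S x) = x" if "length x = d" for x
    using that \<pi>_less permutes_inverses[OF \<pi>]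
    by (auto intro!: nth_equalityI simp: S_def \<sigma>_sq)
  then show "bij_betw ?T (lattice d) (lattice d)"
    by (intro bij_betw_byWitness[of _ S]) (auto simp: lattice_def S_def)
  fix x y assume xy: "x \<in> lattice d" "y \<in> lattice d"
  then have "(\<Sum>l<d. \<bar>?T y ! l - ?T x ! l\<bar>) = (\<Sum>l<d. \<bar>\<sigma> l\<bar> * \<bar>y ! \<pi> l - x ! \<pi> l\<bar>)"
    by (intro sum.cong) (auto simp: lattice_def algebra_simps simp flip: abs_mult)
  also have "\<dots> = (\<Sum>l<d. \<bar>y ! l - x ! l\<bar>)"
    using \<sigma> sum.permute[OF \<pi>, of "\<lambda>l. \<bar>y ! l - x ! l\<bar>"] by simp
  finally show "nbr (?T x) (?T y) \<longleftrightarrow> nbr x y"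
    using xy by (simp add: nbr_def lattice_def)
qed (use xy in \<open>simp_all add: lattice_def\<close>)

lemma green_diag_eq:
  assumes "length x = d"
  shows "green x x = green (origin d) (origin d)"
proof -
  have "lattice_isometry (\<lambda>_. 1) id x x = origin d"
    using assms by (intro nth_equalityI) (auto simp: origin_def)
  then show ?thesis
    using green_lattice_isometry[of id d "\<lambda>_. 1" x x x] assms by (simp add: permutes_id)
qed

lemma hypercube_length: "v \<in> hypercube d \<Longrightarrow> length v = d"
  by (simp add: hypercube_def)

lemma hypercube_nth: "v \<in> hypercube d \<Longrightarrow> i < d \<Longrightarrow> v ! i = 0 \<or> v ! i = 1"
  using nth_mem[of i v] unfolding hypercube_def by blast

definition flip :: "int list \<Rightarrow> nat \<Rightarrow> int list" where
  "flip v i = v[i := 1 - v ! i]"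

lemma length_flip [simp]: "length (flip v i) = length v"
  by (simp add: flip_def)

lemma nth_flip: "i < length v \<Longrightarrow> flip v i ! j = (if j = i then 1 - v ! i else v ! j)"
  by (simp add: flip_def nth_list_update)

lemma flip_neq_nth:
  assumes "i < length v"
  shows "flip v i ! i \<noteq> v ! i"
proof -
  have "1 - z \<noteq> z" for z :: int by presburger
  then show ?thesis using assms by (simp add: nth_flip)
qed

lemma inj_on_flip: "inj_on (flip v) {..<length v}"
proof (rule inj_onI)
  fix i j assume "i \<in> {..<length v}" "j \<in> {..<length v}" "flip v i = flip v j"
  then show "i = j" using flip_neq_nth[of i v] by (auto simp: nth_flip split: if_splits)
qed

lemma lattice_isometry_flip:
  assumes v: "v \<in> hypercube d" and \<pi>: "\<pi> permutes {..<d}" and "l < d"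
  shows "lattice_isometry (\<lambda>k. 1 - 2 * v ! \<pi> k) \<pi> v (flip v (\<pi> l)) = flip (origin d) l"
proof (rule nth_equalityI)
  have \<pi>_less: "\<pi> k < d" if "k < d" for k using that permutes_in_image[OF \<pi>, of k] by simp
  have \<pi>_eq: "\<pi> k = \<pi> l \<longleftrightarrow> k = l" for k using permutes_inj[OF \<pi>] by (simp add: inj_eq)
  fix k assume "k < length (lattice_isometry (\<lambda>k. 1 - 2 * v ! \<pi> k) \<pi> v (flip v (\<pi> l)))"
  then have "k < d" using v by (simp add: hypercube_length)
  note nth = \<open>k < d\<close> \<open>l < d\<close> \<pi>_less hypercube_length[OF v] nth_flip origin_def
  show "lattice_isometry (\<lambda>k. 1 - 2 * v ! \<pi> k) \<pi> v (flip v (\<pi> l)) ! k = flip (origin d) l ! k"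
  proof (cases "k = l")
    case True
    then show ?thesis using hypercube_nth[OF v \<pi>_less[OF \<open>l < d\<close>]]
      by (elim disjE) (simp_all add: nth)
  next
    case False
    then show ?thesis by (simp add: nth \<pi>_eq)
  qed
qed (use v in \<open>simp add: hypercube_length origin_def\<close>)

lemma permutes_prescribed_pair:
  assumes "{a, b, i, j} \<subseteq> S" "a \<noteq> b" "i \<noteq> j"
  obtains \<pi> where "\<pi> permutes S" "\<pi> a = i" "\<pi> b = j"
proof
  let ?j = "Transposition.transpose a i j"
  let ?\<pi> = "Transposition.transpose a i \<circ> Transposition.transpose b ?j"
  have "?j \<in> S" "?j \<noteq> a" using assms by (auto simp: Transposition.transpose_def)
  then show "?\<pi> permutes S" "?\<pi> a = i" "?\<pi> b = j"
    using assms by (auto intro!: permutes_compose permutes_swap_id)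
qed

lemma green_flip_flip:
  assumes v: "v \<in> hypercube d" and ij: "i < d" "j < d" "i \<noteq> j"
  shows "green (flip v i) (flip v j) = green (flip (origin d) 0) (flip (origin d) 1)"
proof -
  have "d \<ge> 2" using ij by linarith
  then obtain \<pi> where \<pi>: "\<pi> permutes {..<d}" "\<pi> 0 = i" "\<pi> 1 = j"
    using permutes_prescribed_pair[of 0 1 i j "{..<d}"] ij by auto
  have "\<bar>1 - 2 * v ! \<pi> l\<bar> = 1" if "l < d" for l
    using hypercube_nth[OF v, of "\<pi> l"] permutes_in_image[OF \<pi>(1), of l] that by auto
  then show ?thesis
    using green_lattice_isometry[OF \<pi>(1), of "\<lambda>l. 1 - 2 * v ! \<pi> l" "flip v i" "flip v j" v]
      lattice_isometry_flip[OF v \<pi>(1), of 0] lattice_isometry_flip[OF v \<pi>(1), of 1] \<pi> \<open>d \<ge> 2\<close> v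
    by (simp add: hypercube_length)
qed

section \<open>Gaussian vectors from characteristic functions\<close>

lemma (in prob_space) prob_eq_integral_indicator:
  assumes [measurable]: "X \<in> borel_measurable M" "A \<in> sets borel"
  shows "prob {\<omega> \<in> space M. X \<omega> \<in> A} = (LINT \<omega>|M. indicator A (X \<omega>))"
proof -
  have "(LINT \<omega>|M. indicator A (X \<omega>)) = (LINT \<omega>|M. indicat_real {\<omega> \<in> space M. X \<omega> \<in> A} \<omega>)"
    by (intro Bochner_Integration.integral_cong) (auto simp: indicator_def)
  then show ?thesis by simp
qed

definition normalized_density :: "'a measure \<Rightarrow> ('a \<Rightarrow> real) \<Rightarrow> 'a measure" where
  "normalized_density M W = density M (\<lambda>\<omega>. ennreal (W \<omega> / (LINT \<omega>|M. W \<omega>)))"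

lemma prob_space_normalized_density:
  assumes W: "integrable M W" "\<And>\<omega>. 0 \<le> W \<omega>" "0 < (LINT \<omega>|M. W \<omega>)"
  shows "prob_space (normalized_density M W)"
proof (rule prob_spaceI)
  note [measurable] = borel_measurable_integrable[OF W(1)]
  have "emeasure (normalized_density M W) (space (normalized_density M W))
      = (\<integral>\<^sup>+\<omega>. ennreal (W \<omega> / (LINT \<omega>|M. W \<omega>)) \<partial>M)"
    unfolding normalized_density_def by (simp add: emeasure_density cong: nn_integral_cong)
  also have "\<dots> = ennreal (LINT \<omega>|M. W \<omega> / (LINT \<omega>|M. W \<omega>))"
    using W by (intro nn_integral_eq_integral) auto
  also have "(LINT \<omega>|M. W \<omega> / (LINT \<omega>|M. W \<omega>)) = 1" using W(3) by simp
  finally show "emeasure (normalized_density M W) (space (normalized_density M W)) = 1" by simp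
qed

lemma integral_normalized_density:
  fixes f :: "'a \<Rightarrow> 'b :: {banach, second_countable_topology}"
  assumes W: "integrable M W" "\<And>\<omega>. 0 \<le> W \<omega>" "0 < (LINT \<omega>|M. W \<omega>)"
    and f [measurable]: "f \<in> borel_measurable M"
  shows "(LINT \<omega>|normalized_density M W. f \<omega>) = (1 / (LINT \<omega>|M. W \<omega>)) *\<^sub>R (LINT \<omega>|M. W \<omega> *\<^sub>R f \<omega>)"
proof -
  note [measurable] = borel_measurable_integrable[OF W(1)]
  have "(LINT \<omega>|normalized_density M W. f \<omega>) = (LINT \<omega>|M. (W \<omega> / (LINT \<omega>|M. W \<omega>)) *\<^sub>R f \<omega>)"
    unfolding normalized_density_def using W by (subst integral_density) auto
  also have "\<dots> = (LINT \<omega>|M. (1 / (LINT \<omega>|M. W \<omega>)) *\<^sub>R (W \<omega> *\<^sub>R f \<omega>))" by simp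
  finally show ?thesis by (simp only: integral_scaleR_right)
qed

lemma (in prob_space) integral_mult_indicator_if_iexp_nonneg:
  fixes X W :: "'a \<Rightarrow> real"
  assumes X [measurable]: "X \<in> borel_measurable M"
    and W: "integrable M W" "\<And>\<omega>. 0 \<le> W \<omega>" "0 < (LINT \<omega>|M. W \<omega>)"
    and iexp: "\<And>s. (CLINT \<omega>|M. W \<omega> *\<^sub>R iexp (s * X \<omega>))
      = (LINT \<omega>|M. W \<omega>) *\<^sub>R (CLINT \<omega>|M. iexp (s * X \<omega>))"
    and A [measurable]: "A \<in> sets borel"
  shows "(LINT \<omega>|M. W \<omega> * indicator A (X \<omega>)) = (LINT \<omega>|M. W \<omega>) * prob {\<omega> \<in> space M. X \<omega> \<in> A}"
proof -
  define N where "N = normalized_density M W"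
  have [measurable_cong, simp]: "sets N = sets M" by (simp add: N_def normalized_density_def)
  interpret N: prob_space N unfolding N_def using W by (rule prob_space_normalized_density)
  have "char (distr N borel X) s = char (distr M borel X) s" for s
  proof -
    have "char (distr N borel X) s = (CLINT \<omega>|N. iexp (s * X \<omega>))"
      unfolding char_def by (subst integral_distr) auto
    also have "\<dots> = (1 / (LINT \<omega>|M. W \<omega>)) *\<^sub>R (CLINT \<omega>|M. W \<omega> *\<^sub>R iexp (s * X \<omega>))"
      unfolding N_def by (rule integral_normalized_density[OF W]) measurable
    also have "\<dots> = (CLINT \<omega>|M. iexp (s * X \<omega>))"
      unfolding iexp using W(3) by simp
    also have "\<dots> = char (distr M borel X) s"
      unfolding char_def by (subst integral_distr) auto
    finally show ?thesis .
  qed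
  then have eq: "distr N borel X = distr M borel X"
    by (intro Levy_uniqueness N.real_distribution_distr real_distribution_distr ext) auto
  have "(LINT \<omega>|M. W \<omega> * indicator A (X \<omega>)) / (LINT \<omega>|M. W \<omega>) = N.prob {\<omega> \<in> space N. X \<omega> \<in> A}"
    using integral_normalized_density[OF W, of "\<lambda>\<omega>. indicat_real A (X \<omega>)"]
    by (simp add: N.prob_eq_integral_indicator N_def[symmetric])
  also have "\<dots> = measure (distr N borel X) A"
    by (subst measure_distr) (auto intro!: arg_cong[of _ _ N.prob])
  also have "\<dots> = prob {\<omega> \<in> space M. X \<omega> \<in> A}"
    unfolding eq by (subst measure_distr) (auto intro!: arg_cong[of _ _ prob])
  finally show ?thesis using W(3) by (simp add: field_simps)
qed

text \<open>Adding a constant to \<open>U\<close> makes it positive, hence proportional to a density, to which Levy's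
  uniqueness theorem for probability measures applies.\<close>

lemma (in prob_space) integral_mult_indicator_if_iexp_real:
  fixes X U :: "'a \<Rightarrow> real"
  assumes X [measurable]: "X \<in> borel_measurable M" and U [measurable]: "U \<in> borel_measurable M"
    and bound: "\<And>\<omega>. \<bar>U \<omega>\<bar> \<le> K"
    and iexp: "\<And>s. (CLINT \<omega>|M. U \<omega> *\<^sub>R iexp (s * X \<omega>))
      = (LINT \<omega>|M. U \<omega>) *\<^sub>R (CLINT \<omega>|M. iexp (s * X \<omega>))"
    and A [measurable]: "A \<in> sets borel"
  shows "(LINT \<omega>|M. U \<omega> * indicator A (X \<omega>)) = (LINT \<omega>|M. U \<omega>) * prob {\<omega> \<in> space M. X \<omega> \<in> A}"
proof -
  define W where "W \<omega> = K + 1 + U \<omega>" for \<omega>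
  have integrable_mult_U: "integrable M (\<lambda>\<omega>. U \<omega> *\<^sub>R f \<omega>)" and integrable_bounded: "integrable M f"
    if [measurable]: "f \<in> borel_measurable M" and f: "\<And>\<omega>. norm (f \<omega>) \<le> 1"
    for f :: "'a \<Rightarrow> 'b :: {banach, second_countable_topology}"
  proof -
    have "\<bar>U \<omega>\<bar> * norm (f \<omega>) \<le> K * 1" for \<omega>
      using order_trans[OF abs_ge_zero bound] by (intro mult_mono bound f) auto
    then show "integrable M (\<lambda>\<omega>. U \<omega> *\<^sub>R f \<omega>)"
      by (intro integrable_const_bound[of _ K]) auto
    show "integrable M f" using f by (intro integrable_const_bound[of _ 1]) auto
  qed
  have integral_W: "(LINT \<omega>|M. W \<omega> *\<^sub>R f \<omega>) = (K + 1) *\<^sub>R (LINT \<omega>|M. f \<omega>) + (LINT \<omega>|M. U \<omega> *\<^sub>R f \<omega>)"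
    if [measurable]: "f \<in> borel_measurable M" and f: "\<And>\<omega>. norm (f \<omega>) \<le> 1"
    for f :: "'a \<Rightarrow> 'b :: {banach, second_countable_topology}"
    using integrable_mult_U[OF that] integrable_bounded[OF that]
    by (simp add: W_def scaleR_add_left)
  have U_integrable: "integrable M U" using bound by (intro integrable_const_bound[of _ K]) auto
  have W_ge_1: "1 \<le> W \<omega>" for \<omega> using bound[of \<omega>] by (simp add: W_def)
  have W_integrable: "integrable M W" unfolding W_def using U_integrable by simp
  have W_mean: "(LINT \<omega>|M. W \<omega>) = K + 1 + (LINT \<omega>|M. U \<omega>)"
    unfolding W_def using U_integrable by (simp add: prob_space)
  have "(LINT \<omega>|M. W \<omega> * indicator A (X \<omega>)) = (LINT \<omega>|M. W \<omega>) * prob {\<omega> \<in> space M. X \<omega> \<in> A}"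
  proof (rule integral_mult_indicator_if_iexp_nonneg[OF X W_integrable _ _ _ A])
    show "0 \<le> W \<omega>" for \<omega> using W_ge_1[of \<omega>] by simp
    have "1 \<le> (LINT \<omega>|M. W \<omega>)" using W_ge_1 W_integrable by (intro integral_ge_const) auto
    then show "0 < (LINT \<omega>|M. W \<omega>)" by simp
    fix s
    have "(CLINT \<omega>|M. W \<omega> *\<^sub>R iexp (s * X \<omega>))
        = (K + 1) *\<^sub>R (CLINT \<omega>|M. iexp (s * X \<omega>)) + (CLINT \<omega>|M. U \<omega> *\<^sub>R iexp (s * X \<omega>))"
      by (rule integral_W) auto
    then show "(CLINT \<omega>|M. W \<omega> *\<^sub>R iexp (s * X \<omega>))
        = (LINT \<omega>|M. W \<omega>) *\<^sub>R (CLINT \<omega>|M. iexp (s * X \<omega>))"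
      by (simp only: iexp W_mean scaleR_add_left)
  qed
  then show ?thesis
    using integral_W[of "\<lambda>\<omega>. indicat_real A (X \<omega>)"]
    by (simp add: W_mean prob_eq_integral_indicator distrib_right)
qed

lemma (in prob_space) integral_Re_iexp:
  fixes X :: "'a \<Rightarrow> real" and W :: "'a \<Rightarrow> complex"
  assumes X [measurable]: "X \<in> borel_measurable M" and W: "integrable M W"
    and iexp: "\<And>s. (CLINT \<omega>|M. W \<omega> * iexp (s * X \<omega>))
      = (CLINT \<omega>|M. W \<omega>) * (CLINT \<omega>|M. iexp (s * X \<omega>))"
  shows "(CLINT \<omega>|M. Re (W \<omega>) *\<^sub>R iexp (s * X \<omega>))
    = (LINT \<omega>|M. Re (W \<omega>)) *\<^sub>R (CLINT \<omega>|M. iexp (s * X \<omega>))"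
proof -
  note [measurable] = borel_measurable_integrable[OF W]
  have integrable_W_iexp: "integrable M (\<lambda>\<omega>. W \<omega> * iexp (s * X \<omega>))" for s
    by (rule Bochner_Integration.integrable_bound[OF W]) (auto simp: norm_mult)
  have cnj_iexp: "cnj (iexp (- s * X \<omega>)) = iexp (s * X \<omega>)" for \<omega>
    by (simp add: exp_cnj)
  have integrable_cnj_iexp: "integrable M (\<lambda>\<omega>. cnj (W \<omega>) * iexp (s * X \<omega>))"
    using integrable_cnj[OF integrable_W_iexp[of "- s"]] by (simp only: complex_cnj_mult cnj_iexp)
  have "(CLINT \<omega>|M. cnj (W \<omega>) * iexp (s * X \<omega>)) = cnj (CLINT \<omega>|M. W \<omega> * iexp (- s * X \<omega>))"
    unfolding cnj_iexp[symmetric] complex_cnj_mult[symmetric]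
    by (rule Bochner_Integration.integral_cnj)
  moreover have "(CLINT \<omega>|M. iexp (s * X \<omega>)) = cnj (CLINT \<omega>|M. iexp (- s * X \<omega>))"
    unfolding cnj_iexp[symmetric] by (rule Bochner_Integration.integral_cnj)
  ultimately have iexp_cnj: "(CLINT \<omega>|M. cnj (W \<omega>) * iexp (s * X \<omega>))
      = cnj (CLINT \<omega>|M. W \<omega>) * (CLINT \<omega>|M. iexp (s * X \<omega>))"
    by (simp only: iexp complex_cnj_mult)
  have scaleR_Re: "Re z *\<^sub>R w = (z * w + cnj z * w) / 2" for z w
    by (simp add: scaleR_conv_of_real complex_add_cnj distrib_right[symmetric])
  have "(CLINT \<omega>|M. Re (W \<omega>) *\<^sub>R iexp (s * X \<omega>))
      = ((CLINT \<omega>|M. W \<omega> * iexp (s * X \<omega>)) + (CLINT \<omega>|M. cnj (W \<omega>) * iexp (s * X \<omega>))) / 2"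
    using integrable_W_iexp[of s] integrable_cnj_iexp
    by (simp only: scaleR_Re integral_divide_zero Bochner_Integration.integral_add)
  also have "\<dots> = Re (CLINT \<omega>|M. W \<omega>) *\<^sub>R (CLINT \<omega>|M. iexp (s * X \<omega>))"
    by (simp only: iexp iexp_cnj scaleR_Re)
  finally show ?thesis using W by simp
qed

lemma (in prob_space) integral_mult_indicator_if_iexp:
  fixes X :: "'a \<Rightarrow> real" and W :: "'a \<Rightarrow> complex"
  assumes X [measurable]: "X \<in> borel_measurable M" and W [measurable]: "W \<in> borel_measurable M"
    and bound: "\<And>\<omega>. norm (W \<omega>) \<le> K"
    and iexp: "\<And>s. (CLINT \<omega>|M. W \<omega> * iexp (s * X \<omega>))
      = (CLINT \<omega>|M. W \<omega>) * (CLINT \<omega>|M. iexp (s * X \<omega>))"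
    and A [measurable]: "A \<in> sets borel"
  shows "(CLINT \<omega>|M. W \<omega> * indicator A (X \<omega>))
    = (CLINT \<omega>|M. W \<omega>) * prob {\<omega> \<in> space M. X \<omega> \<in> A}"
proof -
  have Re_part: "(LINT \<omega>|M. Re (V \<omega>) * indicator A (X \<omega>))
      = Re (CLINT \<omega>|M. V \<omega>) * prob {\<omega> \<in> space M. X \<omega> \<in> A}"
    if [measurable]: "V \<in> borel_measurable M" and V_bound: "\<And>\<omega>. norm (V \<omega>) \<le> K"
      and V_iexp: "\<And>s. (CLINT \<omega>|M. V \<omega> * iexp (s * X \<omega>))
        = (CLINT \<omega>|M. V \<omega>) * (CLINT \<omega>|M. iexp (s * X \<omega>))" for V
  proof -
    have V: "integrable M V" using V_bound by (intro integrable_const_bound[of _ K]) auto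
    have "\<bar>Re (V \<omega>)\<bar> \<le> K" for \<omega> using abs_Re_le_cmod V_bound by (rule order_trans)
    from integral_mult_indicator_if_iexp_real[OF X _ this integral_Re_iexp[OF X V V_iexp] A]
    show ?thesis using V by simp
  qed
  have "K \<ge> 0" using norm_ge_zero bound by (rule order_trans)
  then have integrable_W_indicator: "integrable M (\<lambda>\<omega>. W \<omega> * indicator A (X \<omega>))"
    using bound by (intro integrable_const_bound[of _ K]) (auto simp: indicator_def)
  show ?thesis
  proof (rule complex_eqI)
    have "Re (W \<omega> * indicator A (X \<omega>)) = Re (W \<omega>) * indicator A (X \<omega>)" for \<omega>
      by (simp add: indicator_def)
    then show "Re (CLINT \<omega>|M. W \<omega> * indicator A (X \<omega>))
        = Re ((CLINT \<omega>|M. W \<omega>) * prob {\<omega> \<in> space M. X \<omega> \<in> A})"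
      using integrable_W_indicator Re_part[OF W bound iexp] by (simp flip: integral_Re)
    have "Im (W \<omega> * indicator A (X \<omega>)) = Re (- \<i> * W \<omega>) * indicator A (X \<omega>)" for \<omega>
      by (simp add: indicator_def)
    then show "Im (CLINT \<omega>|M. W \<omega> * indicator A (X \<omega>))
        = Im ((CLINT \<omega>|M. W \<omega>) * prob {\<omega> \<in> space M. X \<omega> \<in> A})"
      using integrable_W_indicator Re_part[of "\<lambda>\<omega>. - \<i> * W \<omega>"] bound iexp
      by (simp add: norm_mult mult.assoc flip: integral_Im)
  qed
qed

lemma (in prob_space) integral_mult_indicator_if_char:
  fixes X :: "'a \<Rightarrow> real" and W :: "'a \<Rightarrow> complex"
  assumes X [measurable]: "X \<in> borel_measurable M" and W: "W \<in> borel_measurable M"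
    and bound: "\<And>\<omega>. norm (W \<omega>) \<le> K"
    and char: "\<And>s. (CLINT \<omega>|M. W \<omega> * iexp (s * X \<omega>)) = z * char (distr M borel X) s"
    and A: "A \<in> sets borel"
  shows "(CLINT \<omega>|M. W \<omega> * indicator A (X \<omega>)) = z * prob {\<omega> \<in> space M. X \<omega> \<in> A}"
proof -
  have char_distr: "char (distr M borel X) s = (CLINT \<omega>|M. iexp (s * X \<omega>))" for s
    unfolding char_def by (subst integral_distr) auto
  have z: "z = (CLINT \<omega>|M. W \<omega>)" using char[of 0] by (simp add: char_distr prob_space)
  show ?thesis
    using integral_mult_indicator_if_iexp[OF X W bound _ A] char by (simp only: z char_distr)
qed

lemma (in prob_space) integral_indicators_mult_iexp:
  fixes X :: "'i \<Rightarrow> 'a \<Rightarrow> real"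
  assumes "finite I" and X: "\<And>i. i \<in> I \<Longrightarrow> X i \<in> borel_measurable M"
    and char: "\<And>t. (CLINT \<omega>|M. iexp (\<Sum>i\<in>I. t i * X i \<omega>)) = (\<Prod>i\<in>I. char (distr M borel (X i)) (t i))"
    and A: "\<And>i. i \<in> I \<Longrightarrow> A i \<in> sets borel"
    and "J \<subseteq> I"
  shows "(CLINT \<omega>|M. (\<Prod>j\<in>J. indicator (A j) (X j \<omega>)) * iexp (\<Sum>i\<in>I - J. t i * X i \<omega>))
    = (\<Prod>j\<in>J. prob {\<omega> \<in> space M. X j \<omega> \<in> A j}) * (\<Prod>i\<in>I - J. char (distr M borel (X i)) (t i))"
  using finite_subset[OF \<open>J \<subseteq> I\<close> \<open>finite I\<close>] \<open>J \<subseteq> I\<close>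
proof (induction J arbitrary: t rule: finite_induct)
  case empty
  then show ?case using char by simp
next
  case (insert k J)
  then have k: "k \<in> I" "k \<notin> J" and J: "J \<subseteq> I" by auto
  have I_minus_J: "I - J = insert k (I - insert k J)" using k by auto
  define W where "W \<omega> =
    (\<Prod>j\<in>J. indicator (A j) (X j \<omega>)) * iexp (\<Sum>i\<in>I - insert k J. t i * X i \<omega>)" for \<omega>
  define p where "p = complex_of_real (\<Prod>j\<in>J. prob {\<omega> \<in> space M. X j \<omega> \<in> A j})"
  define q where "q = (\<Prod>i\<in>I - insert k J. char (distr M borel (X i)) (t i))"
  have "(CLINT \<omega>|M. W \<omega> * indicator (A k) (X k \<omega>)) = p * q * prob {\<omega> \<in> space M. X k \<omega> \<in> A k}"
  proof (rule integral_mult_indicator_if_char[OF X[OF k(1)] _ _ _ A[OF k(1)]])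
    show "W \<in> borel_measurable M" unfolding W_def
      using X A J by (intro borel_measurable_times borel_measurable_prod borel_measurable_exp
        borel_measurable_of_real borel_measurable_sum borel_measurable_const
        measurable_compose[OF _ borel_measurable_indicator]) auto
    show "norm (W \<omega>) \<le> 1" for \<omega>
      by (simp add: W_def norm_mult prod_norm[symmetric] prod_le_1 indicator_def)
    fix s
    have "(\<Sum>i\<in>I - J. (t(k := s)) i * X i \<omega>) = (\<Sum>i\<in>I - insert k J. t i * X i \<omega>) + s * X k \<omega>" for \<omega>
      unfolding I_minus_J using \<open>finite I\<close> by (simp add: add.commute)
    then have "(CLINT \<omega>|M. W \<omega> * iexp (s * X k \<omega>))
        = (CLINT \<omega>|M. (\<Prod>j\<in>J. indicator (A j) (X j \<omega>)) * iexp (\<Sum>i\<in>I - J. (t(k := s)) i * X i \<omega>))"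
      by (simp add: W_def exp_add distrib_left mult.assoc)
    also have "\<dots> = p * (\<Prod>i\<in>I - J. char (distr M borel (X i)) ((t(k := s)) i))"
      unfolding p_def by (rule insert.IH[OF J])
    also have "\<dots> = p * q * char (distr M borel (X k)) s"
      unfolding I_minus_J q_def using \<open>finite I\<close> by (simp add: mult_ac)
    finally show "(CLINT \<omega>|M. W \<omega> * iexp (s * X k \<omega>)) = p * q * char (distr M borel (X k)) s" .
  qed
  moreover have "(\<Prod>j\<in>insert k J. indicator (A j) (X j \<omega>)) * iexp (\<Sum>i\<in>I - insert k J. t i * X i \<omega>)
      = W \<omega> * indicator (A k) (X k \<omega>)" for \<omega>
    using insert.hyps by (simp add: W_def mult_ac)
  moreover have "complex_of_real (\<Prod>j\<in>insert k J. prob {\<omega> \<in> space M. X j \<omega> \<in> A j})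
      = p * prob {\<omega> \<in> space M. X k \<omega> \<in> A k}"
    using insert.hyps by (simp add: p_def mult.commute)
  ultimately show ?case by (simp only: q_def mult_ac)
qed

theorem (in prob_space) indep_vars_if_char_factors:
  fixes X :: "'i \<Rightarrow> 'a \<Rightarrow> real"
  assumes "finite I" "I \<noteq> {}" and X: "\<And>i. i \<in> I \<Longrightarrow> X i \<in> borel_measurable M"
    and char: "\<And>t. (CLINT \<omega>|M. iexp (\<Sum>i\<in>I. t i * X i \<omega>)) = (\<Prod>i\<in>I. char (distr M borel (X i)) (t i))"
  shows "indep_vars (\<lambda>_. borel) X I"
proof (subst indep_vars_finite[where E = "\<lambda>_. sets borel"])
  have "prob (\<Inter>i\<in>I. X i -` A i \<inter> space M) = (\<Prod>i\<in>I. prob (X i -` A i \<inter> space M))"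
    if A: "A \<in> I \<rightarrow> sets borel" for A
  proof -
    define B where "B = {\<omega> \<in> space M. \<forall>i\<in>I. X i \<omega> \<in> A i}"
    have B_eq: "(\<Inter>i\<in>I. X i -` A i \<inter> space M) = B"
      using \<open>I \<noteq> {}\<close> by (auto simp: B_def)
    have B: "B \<in> sets M" unfolding B_eq[symmetric]
      using X A assms(1,2) by (intro sets.finite_INT measurable_sets) auto
    have "(\<Prod>i\<in>I. indicator (A i) (X i \<omega>)) = complex_of_real (indicator B \<omega>)"
      if \<omega>: "\<omega> \<in> space M" for \<omega>
    proof (cases "\<omega> \<in> B")
      case True
      then show ?thesis by (simp add: B_def)
    next
      case False
      then have "\<exists>i\<in>I. indicator (A i) (X i \<omega>) = (0::complex)"
        using \<omega> by (auto simp: B_def indicator_def)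
      then show ?thesis using False \<open>finite I\<close> by (simp add: prod_zero)
    qed
    then have "complex_of_real (prob B) = (CLINT \<omega>|M. (\<Prod>i\<in>I. indicator (A i) (X i \<omega>)))"
      using B by (subst Bochner_Integration.integral_cong[OF refl]) auto
    also have "\<dots> = complex_of_real (\<Prod>i\<in>I. prob {\<omega> \<in> space M. X i \<omega> \<in> A i})"
      using integral_indicators_mult_iexp[OF \<open>finite I\<close> X char _ order_refl] A by (simp add: Pi_iff)
    finally show ?thesis
      unfolding of_real_eq_iff B_eq by (simp add: vimage_def Int_def conj_commute)
  qed
  then show "\<forall>A\<in>I \<rightarrow> sets borel.
      prob (\<Inter>j\<in>I. X j -` A j \<inter> space M) = (\<Prod>j\<in>I. prob (X j -` A j \<inter> space M))"
    by blast
qed (use assms in \<open>auto simp: Int_stable_def sets.sigma_sets_eq[of borel, simplified]\<close>)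

text \<open>A push-forward rather than a density, so that \<open>v = 0\<close> gives the point mass at \<open>0\<close>.\<close>

definition centered_normal :: "real \<Rightarrow> real measure" where
  "centered_normal v = distr std_normal_distribution borel (\<lambda>x. sqrt v * x)"

lemma real_distribution_centered_normal: "real_distribution (centered_normal v)"
proof -
  interpret N: real_distribution std_normal_distribution by (rule real_dist_normal_dist)
  show ?thesis unfolding centered_normal_def by (intro N.real_distribution_distr) simp
qed

lemma char_centered_normal:
  assumes "v \<ge> 0"
  shows "char (centered_normal v) s = of_real (exp (- (v * s\<^sup>2) / 2))"
proof -
  have "char (centered_normal v) s = char std_normal_distribution (s * sqrt v)"
    unfolding char_def centered_normal_def by (subst integral_distr) (auto simp: mult_ac)
  then show ?thesis using assms
    by (simp add: char_std_normal_distribution power_mult_distrib mult.commute)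
qed

lemma measure_centered_normal:
  assumes [measurable]: "A \<in> sets borel"
  shows "measure (centered_normal v) A = measure std_normal_distribution {x. sqrt v * x \<in> A}"
  unfolding centered_normal_def by (subst measure_distr) (auto simp: vimage_def)

lemma measure_std_normal:
  assumes [measurable]: "A \<in> sets borel"
  shows "measure std_normal_distribution A = (LINT x|lborel. std_normal_density x * indicator A x)"
proof -
  interpret N: real_distribution std_normal_distribution by (rule real_dist_normal_dist)
  have "measure std_normal_distribution A = (LINT x|std_normal_distribution. indicator A x)"
    by simp
  also have "\<dots> = (LINT x|lborel. std_normal_density x *\<^sub>R indicator A x)"
    by (subst integral_density) auto
  finally show ?thesis by simp
qed

lemma std_normal_lower_tail_le:
  assumes "u \<ge> 0"
  shows "measure std_normal_distribution {..< -u} \<le> exp (- u\<^sup>2 / 2)"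
proof -
  have "(LINT x|lborel. std_normal_density x * indicator {..< -u} x)
      \<le> (LINT x|lborel. exp (- u\<^sup>2 / 2) * normal_density (-u) 1 x)"
  proof (rule integral_mono)
    show "integrable lborel (\<lambda>x. std_normal_density x * indicat_real {..< - u} x)"
      by (intro integrable_real_mult_indicator) auto
    show "integrable lborel (\<lambda>x. exp (- u\<^sup>2 / 2) * normal_density (-u) 1 x)" by simp
    fix x :: real
    show "std_normal_density x * indicat_real {..< - u} x
        \<le> exp (- u\<^sup>2 / 2) * normal_density (-u) 1 x"
    proof (cases "x < -u")
      case True
      then have "(- u - x) * u \<ge> 0" using assms by (intro mult_nonneg_nonneg) auto
      then have "- x\<^sup>2 / 2 \<le> - u\<^sup>2 / 2 + (- (x + u)\<^sup>2 / 2)"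
        by (simp add: power2_eq_square field_simps)
      then have "exp (- x\<^sup>2 / 2) \<le> exp (- u\<^sup>2 / 2) * exp (- (x + u)\<^sup>2 / 2)"
        unfolding exp_add[symmetric] by simp
      then show ?thesis using True by (simp add: normal_density_def divide_right_mono)
    qed (simp add: normal_density_nonneg)
  qed
  then show ?thesis by (simp add: measure_std_normal)
qed

lemma centered_normal_lower_tail_le:
  assumes "0 \<le> v" "v \<le> \<tau>" "\<tau> > 0" "u \<ge> 0"
  shows "measure (centered_normal v) {..< -u} \<le> exp (- (u\<^sup>2 / (2 * \<tau>)))"
proof -
  interpret N: real_distribution std_normal_distribution by (rule real_dist_normal_dist)
  have "{x. sqrt v * x \<in> {..< -u}} \<subseteq> {..< - (u / sqrt \<tau>)}"
  proof (rule subsetI, rule ccontr)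
    fix x assume "x \<in> {x. sqrt v * x \<in> {..< -u}}" and "x \<notin> {..< - (u / sqrt \<tau>)}"
    then have x: "sqrt v * x < - u" "- (u / sqrt \<tau>) \<le> x" by auto
    have "sqrt v * (u / sqrt \<tau>) \<le> sqrt \<tau> * (u / sqrt \<tau>)"
      using assms by (intro mult_right_mono) auto
    also have "\<dots> = u" using assms by simp
    finally have "- u \<le> sqrt v * (- (u / sqrt \<tau>))" by simp
    also have "\<dots> \<le> sqrt v * x" using x assms by (intro mult_left_mono) auto
    finally show False using x by simp
  qed
  then have "measure (centered_normal v) {..< -u}
      \<le> measure std_normal_distribution {..< - (u / sqrt \<tau>)}"
    by (subst measure_centered_normal) (auto intro!: N.finite_measure_mono)
  also have "\<dots> \<le> exp (- (u / sqrt \<tau>)\<^sup>2 / 2)"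
    using assms by (intro std_normal_lower_tail_le) auto
  also have "- (u / sqrt \<tau>)\<^sup>2 / 2 = - (u\<^sup>2 / (2 * \<tau>))" using assms by (simp add: power_divide)
  finally show ?thesis .
qed

definition std_normal_tail :: "real \<Rightarrow> real" where
  "std_normal_tail w = measure std_normal_distribution {w..}"

lemma std_normal_tail_antimono: "w \<le> w' \<Longrightarrow> std_normal_tail w' \<le> std_normal_tail w"
proof -
  interpret N: real_distribution std_normal_distribution by (rule real_dist_normal_dist)
  show "w \<le> w' \<Longrightarrow> std_normal_tail w' \<le> std_normal_tail w"
    unfolding std_normal_tail_def by (intro N.finite_measure_mono) auto
qed

lemma std_normal_tail_ge:
  assumes "w \<ge> 0"
  shows "exp (- (w + 1)\<^sup>2 / 2) / sqrt (2 * pi) \<le> std_normal_tail w"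
proof -
  have "(LINT x|lborel. exp (- (w + 1)\<^sup>2 / 2) / sqrt (2 * pi) * indicator {w..w+1} x)
      \<le> (LINT x|lborel. std_normal_density x * indicator {w..} x)"
  proof (rule integral_mono)
    show "integrable lborel (\<lambda>x. std_normal_density x * indicat_real {w..} x)"
      by (intro integrable_real_mult_indicator) auto
    show "integrable lborel (\<lambda>x. exp (- (w + 1)\<^sup>2 / 2) / sqrt (2 * pi) * indicat_real {w..w+1} x)"
      by (intro integrable_mult_right integrable_real_indicator) (auto simp: emeasure_lborel_Icc_eq)
    fix x :: real
    show "exp (- (w + 1)\<^sup>2 / 2) / sqrt (2 * pi) * indicat_real {w..w+1} x
        \<le> std_normal_density x * indicat_real {w..} x"
    proof (cases "x \<in> {w..w+1}")
      case True
      then have "x\<^sup>2 \<le> (w+1)\<^sup>2" using assms by (intro power_mono) auto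
      then show ?thesis using True by (simp add: std_normal_density_def divide_right_mono)
    qed (simp add: normal_density_nonneg)
  qed
  then show ?thesis by (simp add: measure_std_normal std_normal_tail_def)
qed

lemma measure_centered_normal_lessThan:
  assumes "v > 0"
  shows "measure (centered_normal v) {..<t} = 1 - std_normal_tail (t / sqrt v)"
proof -
  interpret N: real_distribution std_normal_distribution by (rule real_dist_normal_dist)
  have "{x. sqrt v * x \<in> {..<t}} = space std_normal_distribution - {t / sqrt v..}"
    using assms by (auto simp: field_simps not_le)
  then show ?thesis
    by (simp add: measure_centered_normal std_normal_tail_def N.prob_compl[symmetric])
qed

definition (in prob_space) centered_gaussian ::
    "'i set \<Rightarrow> ('i \<Rightarrow> 'a \<Rightarrow> real) \<Rightarrow> ('i \<Rightarrow> 'i \<Rightarrow> real) \<Rightarrow> bool" where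
  "centered_gaussian I X \<Gamma> \<longleftrightarrow> (\<forall>i\<in>I. X i \<in> borel_measurable M) \<and>
    (\<forall>t. (CLINT \<omega>|M. iexp (\<Sum>i\<in>I. t i * X i \<omega>))
      = of_real (exp (- (\<Sum>i\<in>I. \<Sum>j\<in>I. t i * t j * \<Gamma> i j) / 2)))"

context prob_space
begin

lemma centered_gaussian_measurable:
  "centered_gaussian I X \<Gamma> \<Longrightarrow> i \<in> I \<Longrightarrow> X i \<in> borel_measurable M"
  by (simp add: centered_gaussian_def)

lemma centered_gaussian_iexp:
  "centered_gaussian I X \<Gamma> \<Longrightarrow> (CLINT \<omega>|M. iexp (\<Sum>i\<in>I. t i * X i \<omega>))
    = of_real (exp (- (\<Sum>i\<in>I. \<Sum>j\<in>I. t i * t j * \<Gamma> i j) / 2))"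
  unfolding centered_gaussian_def by blast

lemma centered_gaussian_cong:
  assumes "\<And>i. i \<in> I \<Longrightarrow> X i = Y i" "\<And>i j. i \<in> I \<Longrightarrow> j \<in> I \<Longrightarrow> \<Gamma> i j = \<Delta> i j"
  shows "centered_gaussian I X \<Gamma> \<longleftrightarrow> centered_gaussian I Y \<Delta>"
  using assms by (simp add: centered_gaussian_def cong: sum.cong)

lemma centered_gaussian_linear:
  assumes X: "centered_gaussian I X \<Gamma>"
  shows "centered_gaussian J (\<lambda>j \<omega>. \<Sum>i\<in>I. B j i * X i \<omega>) (\<lambda>j k. \<Sum>i\<in>I. \<Sum>l\<in>I. B j i * B k l * \<Gamma> i l)"
  unfolding centered_gaussian_def
proof (intro conjI ballI allI)
  show "(\<lambda>\<omega>. \<Sum>i\<in>I. B j i * X i \<omega>) \<in> borel_measurable M" for j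
    using centered_gaussian_measurable[OF X]
    by (intro borel_measurable_sum borel_measurable_times) auto
  fix t :: "'c \<Rightarrow> real"
  define u where "u i = (\<Sum>j\<in>J. t j * B j i)" for i
  have "(\<Sum>j\<in>J. t j * (\<Sum>i\<in>I. B j i * X i \<omega>)) = (\<Sum>i\<in>I. u i * X i \<omega>)" for \<omega>
    unfolding u_def sum_distrib_left sum_distrib_right
    by (subst sum.swap) (simp add: mult.assoc)
  moreover have "(\<Sum>i\<in>I. \<Sum>l\<in>I. u i * u l * \<Gamma> i l)
      = (\<Sum>j\<in>J. \<Sum>k\<in>J. t j * t k * (\<Sum>i\<in>I. \<Sum>l\<in>I. B j i * B k l * \<Gamma> i l))"
  proof -
    have "(\<Sum>i\<in>I. \<Sum>l\<in>I. u i * u l * \<Gamma> i l)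
        = (\<Sum>i\<in>I. \<Sum>l\<in>I. \<Sum>j\<in>J. \<Sum>k\<in>J. t j * t k * (B j i * B k l * \<Gamma> i l))"
      by (simp only: u_def sum_product) (simp add: sum_distrib_left sum_distrib_right mult_ac)
    also have "\<dots> = (\<Sum>j\<in>J. \<Sum>k\<in>J. \<Sum>i\<in>I. \<Sum>l\<in>I. t j * t k * (B j i * B k l * \<Gamma> i l))"
      by (simp only: sum.swap[of _ J I])
    finally show ?thesis by (simp only: sum_distrib_left)
  qed
  ultimately show "(CLINT \<omega>|M. iexp (\<Sum>j\<in>J. t j * (\<Sum>i\<in>I. B j i * X i \<omega>)))
      = of_real (exp (- (\<Sum>j\<in>J. \<Sum>k\<in>J. t j * t k * (\<Sum>i\<in>I. \<Sum>l\<in>I. B j i * B k l * \<Gamma> i l)) / 2))"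
    using centered_gaussian_iexp[OF X, of u] by simp
qed

lemma centered_gaussian_reindex:
  assumes X: "centered_gaussian I X \<Gamma>" and "finite I" "u ` J \<subseteq> I"
  shows "centered_gaussian J (\<lambda>j. X (u j)) (\<lambda>j k. \<Gamma> (u j) (u k))"
proof -
  have select: "(\<Sum>i\<in>I. of_bool (i = u j) * f i) = f (u j)" if "j \<in> J" for j and f :: "'b \<Rightarrow> real"
    using assms that by (subst sum.mono_neutral_right[of _ "{u j}"]) auto
  show ?thesis
    using centered_gaussian_linear[OF X, of J "\<lambda>j i. of_bool (i = u j)"]
    by (rule iffD1[OF centered_gaussian_cong, rotated -1])
      (simp_all add: select mult.assoc flip: sum_distrib_left)
qed

lemma centered_gaussian_covariance_nonneg:
  assumes "centered_gaussian I X \<Gamma>"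
  shows "0 \<le> (\<Sum>i\<in>I. \<Sum>j\<in>I. t i * t j * \<Gamma> i j)"
proof -
  have "norm (CLINT \<omega>|M. iexp (\<Sum>i\<in>I. t i * X i \<omega>)) \<le> (LINT \<omega>|M. norm (iexp (\<Sum>i\<in>I. t i * X i \<omega>)))"
    by (rule integral_norm_bound)
  also have "\<dots> = 1" by (simp del: of_real_sum add: prob_space)
  finally show ?thesis unfolding centered_gaussian_iexp[OF assms] by simp
qed

lemma centered_gaussian_distr_sum:
  assumes X: "centered_gaussian I X \<Gamma>"
  shows "distr M borel (\<lambda>\<omega>. \<Sum>i\<in>I. b i * X i \<omega>)
    = centered_normal (\<Sum>i\<in>I. \<Sum>j\<in>I. b i * b j * \<Gamma> i j)" (is "distr M borel ?S = centered_normal ?v")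
proof -
  have [measurable]: "?S \<in> borel_measurable M"
    using centered_gaussian_measurable[OF X]
    by (intro borel_measurable_sum borel_measurable_times) auto
  have "char (distr M borel ?S) s = char (centered_normal ?v) s" for s
  proof -
    have "char (distr M borel ?S) s = (CLINT \<omega>|M. iexp (\<Sum>i\<in>I. (s * b i) * X i \<omega>))"
      unfolding char_def by (subst integral_distr) (auto simp: sum_distrib_left mult.assoc)
    also have "\<dots> = of_real (exp (- (\<Sum>i\<in>I. \<Sum>j\<in>I. (s * b i) * (s * b j) * \<Gamma> i j) / 2))"
      by (rule centered_gaussian_iexp[OF X])
    also have "(\<Sum>i\<in>I. \<Sum>j\<in>I. (s * b i) * (s * b j) * \<Gamma> i j) = ?v * s\<^sup>2"
      by (simp add: sum_distrib_left power2_eq_square mult_ac)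
    finally show ?thesis
      using centered_gaussian_covariance_nonneg[OF X, of b] by (simp add: char_centered_normal)
  qed
  then show ?thesis
    by (intro Levy_uniqueness real_distribution_distr real_distribution_centered_normal ext) auto
qed

lemma centered_gaussian_distr:
  assumes X: "centered_gaussian I X \<Gamma>" and "finite I" "i \<in> I"
  shows "distr M borel (X i) = centered_normal (\<Gamma> i i)"
  using centered_gaussian_reindex[OF X \<open>finite I\<close>, of "\<lambda>_. i" "{i}"] \<open>i \<in> I\<close>
    centered_gaussian_distr_sum[of "{i}" "\<lambda>_. X i" "\<lambda>_ _. \<Gamma> i i" "\<lambda>_. 1"]
  by simp

lemma centered_gaussian_indep_vars:
  assumes X: "centered_gaussian I X \<Gamma>" and I: "finite I" "I \<noteq> {}"
    and uncorrelated: "\<And>i j. i \<in> I \<Longrightarrow> j \<in> I \<Longrightarrow> i \<noteq> j \<Longrightarrow> \<Gamma> i j = 0"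
  shows "indep_vars (\<lambda>_. borel) X I"
proof (rule indep_vars_if_char_factors[OF I centered_gaussian_measurable[OF X]])
  fix t :: "'b \<Rightarrow> real"
  have variance_nonneg: "0 \<le> \<Gamma> i i" if "i \<in> I" for i
    using centered_gaussian_reindex[OF X I(1), of "\<lambda>_. i" "{i}"] that
      centered_gaussian_covariance_nonneg[of "{i}" "\<lambda>_. X i" "\<lambda>_ _. \<Gamma> i i" "\<lambda>_. 1"]
    by simp
  have diagonal: "(\<Sum>j\<in>I. t i * t j * \<Gamma> i j) = \<Gamma> i i * (t i)\<^sup>2" if "i \<in> I" for i
    using I that uncorrelated
    by (subst sum.mono_neutral_right[of _ "{i}"]) (auto simp: power2_eq_square)
  have "(\<Prod>i\<in>I. char (distr M borel (X i)) (t i)) = of_real (\<Prod>i\<in>I. exp (- (\<Gamma> i i * (t i)\<^sup>2) / 2))"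
    using centered_gaussian_distr[OF X I(1)] variance_nonneg by (simp add: char_centered_normal)
  also have "(\<Prod>i\<in>I. exp (- (\<Gamma> i i * (t i)\<^sup>2) / 2)) = exp (- (\<Sum>i\<in>I. \<Gamma> i i * (t i)\<^sup>2) / 2)"
    using I by (simp add: exp_sum[symmetric] sum_divide_distrib sum_negf)
  finally show "(CLINT \<omega>|M. iexp (\<Sum>i\<in>I. t i * X i \<omega>)) = (\<Prod>i\<in>I. char (distr M borel (X i)) (t i))"
    unfolding centered_gaussian_iexp[OF X] by (simp add: diagonal)
qed

end

lemma exchangeable_bilinear_form:
  fixes a b :: "'i \<Rightarrow> real"
  assumes "finite I"
  shows "(\<Sum>i\<in>I. \<Sum>j\<in>I. a i * b j * (if i = j then g else \<rho>))
    = (g - \<rho>) * (\<Sum>i\<in>I. a i * b i) + \<rho> * sum a I * sum b I"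
proof -
  have "(\<Sum>j\<in>I. a i * b j * (if i = j then g else \<rho>)) = (g - \<rho>) * (a i * b i) + \<rho> * a i * sum b I"
    if "i \<in> I" for i
  proof -
    have "(\<Sum>j\<in>I. a i * b j * (if i = j then g else \<rho>))
        = (\<Sum>j\<in>I. (if i = j then (g - \<rho>) * (a i * b j) else 0) + \<rho> * a i * b j)"
      by (intro sum.cong) (auto simp: algebra_simps)
    then show ?thesis using that assms by (simp add: sum.distrib sum_distrib_left)
  qed
  then show ?thesis by (simp add: sum.distrib flip: sum_distrib_left sum_distrib_right)
qed

lemma exchangeable_decorrelating_coefficient:
  fixes g \<rho> n :: real
  assumes "0 \<le> \<rho>" "\<rho> < g" "n > 0"
  obtains c where "(g - \<rho>) * (n * c\<^sup>2 - 2 * c) + \<rho> * (1 - n * c)\<^sup>2 = 0"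
    and "c\<^sup>2 * n * (g - \<rho> + n * \<rho>) \<le> \<rho>"
proof
  define \<tau> where "\<tau> = g - \<rho> + n * \<rho>"
  define r where "r = sqrt ((g - \<rho>) / \<tau>)"
  define c where "c = (1 - r) / n"
  have \<tau>: "\<tau> > 0" using assms by (simp add: \<tau>_def add_pos_nonneg)
  have r: "0 \<le> r" "r \<le> 1" and r_sq: "r\<^sup>2 * \<tau> = g - \<rho>"
    using assms \<tau> by (auto simp: r_def \<tau>_def)
  have nc: "1 - n * c = r" using assms by (simp add: c_def)
  have "n * ((g - \<rho>) * (n * c\<^sup>2 - 2 * c) + \<rho> * (1 - n * c)\<^sup>2)
      = (g - \<rho>) * ((1 - n * c)\<^sup>2 - 1) + n * \<rho> * (1 - n * c)\<^sup>2"
    by (simp add: power2_eq_square algebra_simps)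
  also have "\<dots> = r\<^sup>2 * \<tau> - (g - \<rho>)"
    unfolding nc by (simp add: \<tau>_def algebra_simps)
  finally show "(g - \<rho>) * (n * c\<^sup>2 - 2 * c) + \<rho> * (1 - n * c)\<^sup>2 = 0"
    using r_sq assms by simp
  have "n * (c\<^sup>2 * n * \<tau>) = (1 - r)\<^sup>2 * \<tau>"
    using assms by (simp add: c_def power2_eq_square)
  also have "\<dots> \<le> (1 - r\<^sup>2) * \<tau>"
  proof -
    have "(1 - r)\<^sup>2 \<le> (1 - r) * (1 + r)"
      unfolding power2_eq_square using r by (intro mult_left_mono) auto
    then show ?thesis using \<tau>
      by (intro mult_right_mono) (simp_all add: power2_eq_square algebra_simps)
  qed
  also have "\<dots> = n * \<rho>" using r_sq by (simp add: \<tau>_def algebra_simps)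
  finally show "c\<^sup>2 * n * (g - \<rho> + n * \<rho>) \<le> \<rho>"
    using assms by (simp add: \<tau>_def)
qed

lemma exchangeable_decorrelated_covariance:
  fixes g \<rho> c :: real
  assumes I: "finite I" "i \<in> I" "k \<in> I" and n: "n = real (card I)"
    and c: "(g - \<rho>) * (n * c\<^sup>2 - 2 * c) + \<rho> * (1 - n * c)\<^sup>2 = 0"
  shows "(\<Sum>j\<in>I. \<Sum>l\<in>I. (of_bool (i = j) - c) * (of_bool (k = l) - c) * (if j = l then g else \<rho>))
    = (if i = k then g - \<rho> else 0)"
proof -
  have row_sum: "(\<Sum>j\<in>I. of_bool (i = j) - c) = 1 - n * c" if "i \<in> I" for i
    using that I by (simp add: sum_subtractf n)
  have "(\<Sum>j\<in>I. (of_bool (i = j) - c) * (of_bool (k = j) - c))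
      = (\<Sum>j\<in>I. (if i = j then of_bool (k = j) - c else 0) - c * of_bool (k = j) + c\<^sup>2)"
    by (intro sum.cong) (auto simp: power2_eq_square algebra_simps)
  also have "\<dots> = of_bool (k = i) - 2 * c + n * c\<^sup>2"
    using I by (simp add: sum.distrib sum_subtractf n flip: sum_distrib_left)
  finally have row_product: "(\<Sum>j\<in>I. (of_bool (i = j) - c) * (of_bool (k = j) - c))
      = of_bool (k = i) - 2 * c + n * c\<^sup>2" .
  show ?thesis
    unfolding exchangeable_bilinear_form[OF I(1)] row_product row_sum[OF I(2)] row_sum[OF I(3)]
    using c by (auto simp: power2_eq_square algebra_simps)
qed

context prob_space
begin

lemma exchangeable_gaussian_decomposition:
  assumes X: "centered_gaussian I X (\<lambda>i j. if i = j then g else \<rho>)"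
    and I: "finite I" "I \<noteq> {}" and \<rho>: "0 \<le> \<rho>" "\<rho> < g"
  obtains c v where "0 \<le> v" "v \<le> \<rho>"
    and "distr M borel (\<lambda>\<omega>. c * (\<Sum>j\<in>I. X j \<omega>)) = centered_normal v"
    and "indep_vars (\<lambda>_. borel) (\<lambda>i \<omega>. X i \<omega> - c * (\<Sum>j\<in>I. X j \<omega>)) I"
    and "\<And>i. i \<in> I \<Longrightarrow> distr M borel (\<lambda>\<omega>. X i \<omega> - c * (\<Sum>j\<in>I. X j \<omega>)) = centered_normal (g - \<rho>)"
proof -
  define n where "n = real (card I)"
  have n: "n > 0" using I by (simp add: n_def card_gt_0_iff)
  obtain c where c: "(g - \<rho>) * (n * c\<^sup>2 - 2 * c) + \<rho> * (1 - n * c)\<^sup>2 = 0"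
    and c_le: "c\<^sup>2 * n * (g - \<rho> + n * \<rho>) \<le> \<rho>"
    using exchangeable_decorrelating_coefficient[OF \<rho> n] by blast
  define v where "v = c\<^sup>2 * n * (g - \<rho> + n * \<rho>)"
  have "0 \<le> v" "v \<le> \<rho>" using c_le \<rho> n by (auto simp: v_def)
  moreover have "distr M borel (\<lambda>\<omega>. c * (\<Sum>j\<in>I. X j \<omega>)) = centered_normal v"
  proof -
    have "(\<Sum>i\<in>I. \<Sum>j\<in>I. c * c * (if i = j then g else \<rho>)) = v"
      using exchangeable_bilinear_form[OF I(1), of "\<lambda>_. c" "\<lambda>_. c" g \<rho>]
      by (simp add: v_def n_def power2_eq_square algebra_simps)
    then show ?thesis
      using centered_gaussian_distr_sum[OF X, of "\<lambda>_. c"] by (simp only: sum_distrib_left)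
  qed
  moreover have Z: "centered_gaussian I (\<lambda>i \<omega>. X i \<omega> - c * (\<Sum>j\<in>I. X j \<omega>))
      (\<lambda>i j. if i = j then g - \<rho> else 0)"
  proof (rule iffD1[OF centered_gaussian_cong centered_gaussian_linear[OF X]])
    show "(\<lambda>\<omega>. \<Sum>j\<in>I. (of_bool (i = j) - c) * X j \<omega>) = (\<lambda>\<omega>. X i \<omega> - c * (\<Sum>j\<in>I. X j \<omega>))"
      if "i \<in> I" for i
    proof
      fix \<omega>
      have "(\<Sum>j\<in>I. (of_bool (i = j) - c) * X j \<omega>)
          = (\<Sum>j\<in>I. (if i = j then X j \<omega> else 0) - c * X j \<omega>)"
        by (intro sum.cong) (auto simp: algebra_simps)
      then show "(\<Sum>j\<in>I. (of_bool (i = j) - c) * X j \<omega>) = X i \<omega> - c * (\<Sum>j\<in>I. X j \<omega>)"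
        using that I by (simp add: sum_subtractf sum_distrib_left)
    qed
  qed (rule exchangeable_decorrelated_covariance[OF I(1) _ _ n_def c])
  moreover have "indep_vars (\<lambda>_. borel) (\<lambda>i \<omega>. X i \<omega> - c * (\<Sum>j\<in>I. X j \<omega>)) I"
    using I by (rule centered_gaussian_indep_vars[OF Z]) simp
  ultimately show ?thesis using that[of v c] centered_gaussian_distr[OF Z I(1)] by simp
qed

lemma prob_indep_centered_normal_all_below:
  assumes indep: "indep_vars (\<lambda>_. borel) X I" and I: "finite I" "I \<noteq> {}" and "v > 0"
    and distr: "\<And>i. i \<in> I \<Longrightarrow> distr M borel (X i) = centered_normal v"
  shows "prob (\<Inter>i\<in>I. X i -` {..<t} \<inter> space M) \<le> exp (- (card I * std_normal_tail (t / sqrt v)))"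
proof -
  define q where "q = std_normal_tail (t / sqrt v)"
  have X: "X i \<in> borel_measurable M" if "i \<in> I" for i
    using indep that by (simp add: indep_vars_def)
  have "prob (\<Inter>i\<in>I. X i -` {..<t} \<inter> space M) = (\<Prod>i\<in>I. prob (X i -` {..<t} \<inter> space M))"
    using indep I by (intro indep_varsD_finite) auto
  also have "\<dots> = (\<Prod>i\<in>I. measure (distr M borel (X i)) {..<t})"
    using X by (intro prod.cong refl) (simp add: measure_distr)
  also have "\<dots> = (1 - q) ^ card I"
    using distr \<open>v > 0\<close> by (simp add: measure_centered_normal_lessThan q_def)
  also have "\<dots> \<le> exp (- q) ^ card I"
  proof (rule power_mono)
    show "1 - q \<le> exp (- q)" using exp_ge_add_one_self[of "- q"] by simp
    show "0 \<le> 1 - q" using measure_nonneg[of "centered_normal v" "{..<t}"] \<open>v > 0\<close>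
      by (simp add: measure_centered_normal_lessThan q_def)
  qed
  also have "\<dots> = exp (- (card I * q))" by (simp add: exp_of_nat_mult[symmetric])
  finally show ?thesis by (simp add: q_def)
qed

text \<open>Where the subtracted multiple of the sum is at least \<open>-u\<close>, the independent parts must all
  stay below \<open>t + u\<close>.\<close>

lemma exchangeable_gaussian_all_below:
  assumes X: "centered_gaussian I X (\<lambda>i j. if i = j then g else \<rho>)"
    and I: "finite I" "I \<noteq> {}" and \<rho>: "0 \<le> \<rho>" "\<rho> < g" "\<rho> \<le> \<tau>" "\<tau> > 0" and u: "u \<ge> 0"
  shows "prob {\<omega> \<in> space M. \<forall>i\<in>I. X i \<omega> < t}
    \<le> exp (- (card I * std_normal_tail ((t + u) / sqrt (g - \<rho>)))) + exp (- (u\<^sup>2 / (2 * \<tau>)))"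
proof -
  obtain c v where v: "0 \<le> v" "v \<le> \<rho>"
    and R_distr: "distr M borel (\<lambda>\<omega>. c * (\<Sum>j\<in>I. X j \<omega>)) = centered_normal v"
    and Z_indep: "indep_vars (\<lambda>_. borel) (\<lambda>i \<omega>. X i \<omega> - c * (\<Sum>j\<in>I. X j \<omega>)) I"
    and Z_distr: "\<And>i. i \<in> I \<Longrightarrow>
      distr M borel (\<lambda>\<omega>. X i \<omega> - c * (\<Sum>j\<in>I. X j \<omega>)) = centered_normal (g - \<rho>)"
    by (rule exchangeable_gaussian_decomposition[OF X I \<rho>(1,2)]) (rule that)
  define R where "R \<omega> = c * (\<Sum>j\<in>I. X j \<omega>)" for \<omega>
  define Z where "Z i \<omega> = X i \<omega> - R \<omega>" for i \<omega>
  have R [measurable]: "R \<in> borel_measurable M" unfolding R_def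
    using centered_gaussian_measurable[OF X]
    by (intro borel_measurable_times borel_measurable_sum) auto
  have Z: "Z i \<in> borel_measurable M" if "i \<in> I" for i
    unfolding Z_def using centered_gaussian_measurable[OF X that] by measurable
  have "prob {\<omega> \<in> space M. R \<omega> < - u} = measure (distr M borel R) {..< - u}"
    by (subst measure_distr) (auto intro!: arg_cong[of _ _ prob])
  also have "\<dots> \<le> exp (- (u\<^sup>2 / (2 * \<tau>)))"
    using R_distr v \<rho> u by (simp add: R_def[abs_def] centered_normal_lower_tail_le)
  finally have R_bound: "prob {\<omega> \<in> space M. R \<omega> < - u} \<le> exp (- (u\<^sup>2 / (2 * \<tau>)))" .
  let ?E = "\<Inter>i\<in>I. Z i -` {..<t + u} \<inter> space M"
  have Z_bound: "prob ?E \<le> exp (- (card I * std_normal_tail ((t + u) / sqrt (g - \<rho>))))"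
    using Z_indep Z_distr I \<rho>
    by (intro prob_indep_centered_normal_all_below) (auto simp: Z_def[abs_def] R_def)
  have E: "?E \<in> sets M" using Z I by (intro sets.finite_INT measurable_sets) auto
  have "prob {\<omega> \<in> space M. \<forall>i\<in>I. X i \<omega> < t} \<le> prob (?E \<union> {\<omega> \<in> space M. R \<omega> < - u})"
    using E by (intro finite_measure_mono) (auto simp: Z_def)
  also have "\<dots> \<le> prob ?E + prob {\<omega> \<in> space M. R \<omega> < - u}"
    using E by (intro measure_Un_le) simp_all
  finally show ?thesis using Z_bound R_bound by simp
qed

end

section \<open>The free field on the neighbours of a cube vertex\<close>

lemma flip_in_hypercube:
  assumes "v \<in> hypercube d" "i < d"
  shows "flip v i \<in> hypercube d"
proof -
  have "set (flip v i) \<subseteq> insert (1 - v ! i) (set v)"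
    unfolding flip_def by (rule set_update_subset_insert)
  then show ?thesis using assms hypercube_nth[OF assms] by (auto simp: hypercube_def)
qed

lemma nbr_flip:
  assumes "v \<in> hypercube d" "i < d"
  shows "nbr v (flip v i)"
proof -
  have "flip v i = v[i := v ! i + (1 - 2 * v ! i)]" by (simp add: flip_def)
  moreover have "\<bar>1 - 2 * v ! i\<bar> = 1" using hypercube_nth[OF assms] by auto
  ultimately show ?thesis
    using nbr_update[of i v "1 - 2 * v ! i"] assms by (simp add: hypercube_length)
qed

lemma hypercube_subset_lattice: "hypercube d \<subseteq> lattice d"
  by (auto simp: hypercube_def lattice_def)

lemma finite_hypercube: "finite (hypercube d)"
proof -
  have "hypercube d = {xs. set xs \<subseteq> {0, 1} \<and> length xs = d}" by (auto simp: hypercube_def)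
  then show ?thesis using finite_lists_length_eq[of "{0, 1::int}" d] by simp
qed

text \<open>A lower bound for the probability that the independent part at one neighbour exceeds \<open>t + 1\<close>.\<close>

definition exceedance_bound :: "nat \<Rightarrow> real \<Rightarrow> real" where
  "exceedance_bound d t = std_normal_tail ((t + 1) / sqrt (1 - 1 / (real d - 1)))"

definition vacancy_bound :: "nat \<Rightarrow> nat \<Rightarrow> real \<Rightarrow> real" where
  "vacancy_bound d n t = exp (- (n * exceedance_bound d t)) + exp (- ((real d - 1) / 2))"

locale gaussian_free_field = prob_space P
  for P :: "(int list \<Rightarrow> real) measure" and d :: nat +
  assumes gff_law: "gff_law d P"

lemma gaussian_free_fieldI: "gff_law d P \<Longrightarrow> gaussian_free_field P d"
  by (simp add: gaussian_free_field_def gaussian_free_field_axioms_def gff_law_def)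

context gaussian_free_field
begin

lemma coordinate_measurable [measurable]: "(\<lambda>\<omega>. \<omega> x) \<in> borel_measurable P"
proof -
  have "sets P = sets (Pi\<^sub>M UNIV (\<lambda>_::int list. borel :: real measure))"
    using gff_law by (simp add: gff_law_def)
  then show ?thesis
    by (subst measurable_cong_sets[OF _ refl]) (auto intro: measurable_component_singleton)
qed

lemma centered_gaussian_field:
  assumes "finite S" "S \<subseteq> lattice d"
  shows "centered_gaussian S (\<lambda>x \<omega>. \<omega> x) green"
  using gff_law assms unfolding gff_law_def centered_gaussian_def
  by (auto simp del: of_real_sum)

lemma centered_gaussian_flips:
  assumes v: "v \<in> hypercube d" and J: "J \<subseteq> {..<d}"
  shows "centered_gaussian J (\<lambda>i \<omega>. \<omega> (flip v i))
    (\<lambda>i j. if i = j then green (origin d) (origin d)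
      else green (flip (origin d) 0) (flip (origin d) 1))"
proof -
  have "flip v ` J \<subseteq> lattice d" using v J by (auto simp: lattice_def hypercube_length)
  moreover have "finite (flip v ` J)" using J finite_subset by auto
  ultimately have "centered_gaussian J (\<lambda>i \<omega>. \<omega> (flip v i)) (\<lambda>i j. green (flip v i) (flip v j))"
    using centered_gaussian_reindex[OF centered_gaussian_field, of "flip v ` J" "flip v" J] by simp
  then show ?thesis
    using J green_diag_eq[of "flip v _" d] green_flip_flip[OF v] v
    by (subst (asm) centered_gaussian_cong[OF refl, where \<Delta> = "\<lambda>i j. if i = j then
      green (origin d) (origin d) else green (flip (origin d) 0) (flip (origin d) 1)"])
      (auto simp: hypercube_length subset_iff)
qed

lemma prob_all_flips_below:
  assumes v: "v \<in> hypercube d" and d: "d \<ge> 25" and J: "J \<subseteq> {..<d}" "J \<noteq> {}" and t: "t \<ge> 0"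
  shows "prob {\<omega> \<in> space P. \<forall>i\<in>J. \<omega> (flip v i) < t} \<le> vacancy_bound d (card J) t"
proof -
  define g where "g = green (origin d) (origin d)"
  define \<rho> where "\<rho> = green (flip (origin d) 0) (flip (origin d) 1)"
  have origin: "length (origin d) = d" by (simp add: origin_def)
  have "flip (origin d) 0 \<noteq> flip (origin d) 1"
    using inj_onD[OF inj_on_flip[of "origin d"], of 0 1] origin d by auto
  then have \<rho>: "0 \<le> \<rho>" "\<rho> \<le> 1 / (real d - 1)"
    using green_nonneg[of "flip (origin d) 0" d] green_off_diag_le[of "flip (origin d) 0" d]
      origin d by (auto simp: \<rho>_def)
  have g: "1 \<le> g" using green_diag_ge_1[OF origin d] by (simp add: g_def)
  have small: "1 / (real d - 1) < 1" using d by simp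
  then have "\<rho> < g" using \<rho> g by linarith
  have field: "centered_gaussian J (\<lambda>i \<omega>. \<omega> (flip v i)) (\<lambda>i j. if i = j then g else \<rho>)"
    unfolding g_def \<rho>_def using v J(1) by (rule centered_gaussian_flips)
  have "exceedance_bound d t \<le> std_normal_tail ((t + 1) / sqrt (g - \<rho>))"
    unfolding exceedance_bound_def
    using \<rho> g small t by (intro std_normal_tail_antimono divide_left_mono mult_pos_pos) auto
  then have tail: "exp (- (card J * std_normal_tail ((t + 1) / sqrt (g - \<rho>))))
      \<le> exp (- (card J * exceedance_bound d t))"
    by (simp add: mult_left_mono)
  have "prob {\<omega> \<in> space P. \<forall>i\<in>J. \<omega> (flip v i) < t}
      \<le> exp (- (card J * std_normal_tail ((t + 1) / sqrt (g - \<rho>))))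
        + exp (- (1\<^sup>2 / (2 * (1 / (real d - 1)))))"
    using J \<rho> \<open>\<rho> < g\<close> d finite_subset[OF J(1)]
    by (intro exchangeable_gaussian_all_below[OF field]) auto
  also have "\<dots> \<le> vacancy_bound d (card J) t"
    unfolding vacancy_bound_def using tail by simp
  finally show ?thesis .
qed

end

section \<open>Trees in the level set\<close>

fun flip_ball :: "nat \<Rightarrow> int list \<Rightarrow> nat \<Rightarrow> int list set" where
  "flip_ball d x 0 = {x}"
| "flip_ball d x (Suc k) = flip_ball d x k \<union> (\<Union>v\<in>flip_ball d x k. flip v ` {..<d})"

lemma finite_flip_ball: "finite (flip_ball d x k)"
  by (induction k) auto

lemma card_flip_ball_le: "card (flip_ball d x k) \<le> Suc d ^ k"
proof (induction k)
  case (Suc k)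
  have "card (flip_ball d x (Suc k))
      \<le> card (flip_ball d x k) + card (\<Union>v\<in>flip_ball d x k. flip v ` {..<d})"
    by (simp add: card_Un_le)
  also have "card (\<Union>v\<in>flip_ball d x k. flip v ` {..<d})
      \<le> (\<Sum>v\<in>flip_ball d x k. card (flip v ` {..<d}))"
    by (rule card_UN_le[OF finite_flip_ball])
  also have "\<dots> \<le> (\<Sum>v\<in>flip_ball d x k. d)"
    using card_image_le[of "{..<d}"] by (intro sum_mono) auto
  also have "card (flip_ball d x k) + \<dots> = Suc d * card (flip_ball d x k)" by simp
  also have "\<dots> \<le> Suc d ^ Suc k" unfolding power_Suc using Suc.IH by (rule mult_le_mono2)
  finally show ?case by simp
qed simp

lemma flip_ball_mono: "k \<le> m \<Longrightarrow> flip_ball d x k \<subseteq> flip_ball d x m"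
  by (rule lift_Suc_mono_le) auto

lemma flip_ball_subset_hypercube:
  "x \<in> hypercube d \<Longrightarrow> flip_ball d x k \<subseteq> hypercube d"
  by (induction k) (auto intro: flip_in_hypercube)

lemma nn_connected_star:
  assumes connected: "\<And>C. C \<in> \<C> \<Longrightarrow> nn_connected C"
    and adjacent: "\<And>C. C \<in> \<C> \<Longrightarrow> \<exists>u\<in>C. nbr v u"
  shows "nn_connected (insert v (\<Union>\<C>))"
proof -
  define U where "U = insert v (\<Union>\<C>)"
  define R where "R = {(a, b). a \<in> U \<and> b \<in> U \<and> nbr a b}"
  have "sym R" by (auto simp: sym_def R_def intro: nbr_sym)
  then have sym: "sym (R\<^sup>*)" by (rule sym_rtrancl)
  have hub: "(v, a) \<in> R\<^sup>*" if a: "a \<in> U" for a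
  proof (cases "a = v")
    case False
    then obtain C where C: "C \<in> \<C>" "a \<in> C" using a unfolding U_def by blast
    then obtain u where u: "u \<in> C" "nbr v u" using adjacent by blast
    have "(u, a) \<in> {(x, y). x \<in> C \<and> y \<in> C \<and> nbr x y}\<^sup>*"
      using connected[OF C(1)] u C unfolding nn_connected_def by blast
    also have "\<dots> \<subseteq> R\<^sup>*" using C by (intro rtrancl_mono) (auto simp: R_def U_def)
    finally have "(u, a) \<in> R\<^sup>*" .
    moreover have "(v, u) \<in> R" using u C by (auto simp: R_def U_def)
    ultimately show ?thesis by (rule converse_rtrancl_into_rtrancl[rotated])
  qed simp
  have "(a, b) \<in> R\<^sup>*" if "a \<in> U" "b \<in> U" for a b
    using hub[OF that(1)] hub[OF that(2)] sym by (meson rtrancl_trans symD)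
  then show ?thesis unfolding nn_connected_def U_def R_def by simp
qed

text \<open>Sets grown from vertices that differ at some coordinate below \<open>p\<close> are disjoint.\<close>

definition grown_from :: "int list set \<Rightarrow> int list \<Rightarrow> nat \<Rightarrow> nat \<Rightarrow> int list set \<Rightarrow> bool" where
  "grown_from K v p n C \<longleftrightarrow> finite C \<and> v \<in> C \<and> C \<subseteq> K \<and> nn_connected C \<and> n \<le> card C
    \<and> (\<forall>u\<in>C. \<forall>i<p. u ! i = v ! i)"

lemma grown_from_graft:
  assumes v: "v \<in> hypercube d" "v \<in> K" and J: "J \<subseteq> {p..<q}" "p \<le> q" "q \<le> d"
    and C: "\<And>i. i \<in> J \<Longrightarrow> grown_from K (flip v i) q n (C i)"
  shows "grown_from K v p (card J * n) (insert v (\<Union>i\<in>J. C i))"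
proof -
  define U where "U = insert v (\<Union>i\<in>J. C i)"
  have J_less: "i < length v" "i < d" "i < q" "p \<le> i" if "i \<in> J" for i
    using that J v by (auto simp: hypercube_length)
  have finite_J: "finite J" using J finite_subset by auto
  have agree: "u ! l = flip v i ! l" if "i \<in> J" "u \<in> C i" "l < q" for u i l
    using C[OF that(1)] that unfolding grown_from_def by blast
  have "nn_connected U" unfolding U_def
  proof (rule nn_connected_star)
    fix D assume "D \<in> C ` J"
    then obtain i where i: "i \<in> J" "D = C i" by blast
    then show "nn_connected D" using C by (simp add: grown_from_def)
    show "\<exists>u\<in>D. nbr v u" using C i nbr_flip[OF v(1), of i] J_less by (auto simp: grown_from_def)
  qed
  moreover have finite_U: "finite U" and "v \<in> U" "U \<subseteq> K"
    using C finite_J v by (auto simp: U_def grown_from_def)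
  moreover have "u ! l = v ! l" if "u \<in> U" "l < p" for u l
    using that agree J_less J(2) by (fastforce simp: U_def nth_flip)
  moreover have "card J * n \<le> card U"
  proof -
    have disjoint: "C i \<inter> C j = {}" if "i \<in> J" "j \<in> J" "i \<noteq> j" for i j
    proof (rule ccontr)
      assume "C i \<inter> C j \<noteq> {}"
      then obtain u where "u \<in> C i" "u \<in> C j" by blast
      then have "flip v i ! i = flip v j ! i"
        using agree[of i u i] agree[of j u i] that J_less by simp
      also have "\<dots> = v ! i" using that J_less by (simp add: nth_flip)
      finally show False using flip_neq_nth J_less that by blast
    qed
    have "card J * n \<le> (\<Sum>i\<in>J. card (C i))"
      using C by (intro order_trans[OF _ sum_bounded_below]) (auto simp: grown_from_def)
    also have "\<dots> = card (\<Union>i\<in>J. C i)"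
      using C disjoint finite_J by (intro card_UN_disjoint[symmetric]) (auto simp: grown_from_def)
    also have "\<dots> \<le> card U" using finite_U by (intro card_mono) (auto simp: U_def)
    finally show ?thesis .
  qed
  ultimately show ?thesis unfolding grown_from_def U_def[symmetric] by blast
qed

definition block :: "nat \<Rightarrow> nat \<Rightarrow> nat set" where
  "block L b = {b * L..<Suc b * L}"

lemma card_block [simp]: "card (block L b) = L"
  by (simp add: block_def)

lemma block_eq_div: "i \<in> block L b \<Longrightarrow> b = i div L"
  unfolding block_def by (intro div_nat_eqI[symmetric]) (auto simp: mult.commute)

lemma block_subset:
  assumes "a \<le> b" "b < c"
  shows "block L b \<subseteq> {a * L..<c * L}"
proof -
  have "a * L \<le> b * L" "Suc b * L \<le> c * L" using assms by (intro mult_le_mono1; simp)+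
  then show ?thesis unfolding block_def by (intro ivl_subset[THEN iffD2]) simp
qed

text \<open>In the induction, \<open>r\<close> generations are still to be grown and the first \<open>q\<close> blocks of
  coordinates have been used up; the \<open>j\<close>-th child flips a coordinate of block \<open>q + j\<close>.\<close>

lemma grown_from_exists:
  assumes x: "x \<in> hypercube d" and size: "n * L \<le> d"
    and good: "\<And>v b. v \<in> flip_ball d x m \<Longrightarrow> b < n \<Longrightarrow> \<exists>i\<in>block L b. flip v i \<in> K"
    and "k + r \<le> Suc m" "q + r * s \<le> n" "v \<in> flip_ball d x k" "v \<in> K"
  shows "\<exists>C. grown_from K v (q * L) (s ^ r) C"
  using assms(4-)
proof (induction r arbitrary: k q v)
  case 0
  then show ?case by (intro exI[of _ "{v}"]) (auto simp: nn_connected_def grown_from_def)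
next
  case (Suc r)
  have v: "v \<in> flip_ball d x m" using Suc.prems flip_ball_mono[of k m] by auto
  have "q + s \<le> n" using Suc.prems by simp
  have "\<exists>i\<in>block L (q + j). flip v i \<in> K" if "j < s" for j
    using good[OF v] that \<open>q + s \<le> n\<close> by simp
  then obtain i where i: "\<And>j. j < s \<Longrightarrow> i j \<in> block L (q + j) \<and> flip v (i j) \<in> K" by metis
  define J where "J = i ` {..<s}"
  have "i j div L = q + j" if "j < s" for j
    using block_eq_div[of "i j" L "q + j"] i[OF that] by simp
  then have "inj_on i {..<s}" by (metis add_left_cancel inj_onI lessThan_iff)
  then have card_J: "card J = s" by (simp add: J_def card_image)
  have "block L (q + j) \<subseteq> {q * L..<(q + s) * L}" if "j < s" for j
    using that by (intro block_subset) auto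
  then have J: "J \<subseteq> {q * L..<(q + s) * L}" using i unfolding J_def by blast
  have J_d: "(q + s) * L \<le> d"
    using mult_le_mono1[OF \<open>q + s \<le> n\<close>, of L] size by (rule order_trans)
  have "\<exists>C. grown_from K (flip v j) ((q + s) * L) (s ^ r) C" if "j \<in> J" for j
  proof (rule Suc.IH)
    have "j < (q + s) * L" using that J by auto
    then have "j < d" using J_d by (rule less_le_trans)
    then show "flip v j \<in> flip_ball d x (Suc k)" using Suc.prems(3) by auto
    show "flip v j \<in> K" using that i by (auto simp: J_def)
  qed (use Suc.prems in \<open>auto simp: add.assoc\<close>)
  then obtain C where "\<And>j. j \<in> J \<Longrightarrow> grown_from K (flip v j) ((q + s) * L) (s ^ r) (C j)" by metis
  then have "grown_from K v (q * L) (card J * s ^ r) (insert v (\<Union>j\<in>J. C j))"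
    using v flip_ball_subset_hypercube[OF x]
    by (intro grown_from_graft[OF _ Suc.prems(4) J _ J_d]) auto
  then show ?case by (auto simp: card_J)
qed

lemma large_component_exists:
  assumes x: "x \<in> hypercube d" and size: "m * s * L \<le> d" and pos: "m > 0" "s > 0"
    and good: "\<And>v b. v \<in> flip_ball d x m \<Longrightarrow> b < m * s \<Longrightarrow> \<exists>i\<in>block L b. flip v i \<in> K"
  shows "\<exists>y C. nbr x y \<and> y \<in> C \<and> C \<subseteq> K \<and> nn_connected C \<and> s ^ m \<le> card C"
proof -
  have "x \<in> flip_ball d x m" using flip_ball_mono[of 0 m d x] by auto
  then obtain i where i: "i \<in> block L 0" "flip x i \<in> K" using good[of x 0] pos by auto
  have "i < d" using i(1) block_subset[of 0 0 "m * s" L] pos size by force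
  then have "flip x i \<in> flip_ball d x 1" "nbr x (flip x i)" using nbr_flip[OF x] by auto
  then show ?thesis
    using grown_from_exists[OF x size good, where m = m and k = 1 and r = m and q = 0 and s = s
      and v = "flip x i"] i
    by (auto simp: grown_from_def)
qed

section \<open>The union bound\<close>

definition near_substantial :: "real \<Rightarrow> nat \<Rightarrow> real \<Rightarrow> int list \<Rightarrow> (int list \<Rightarrow> real) \<Rightarrow> bool" where
  "near_substantial \<epsilon> d h x \<omega> \<longleftrightarrow>
    (\<exists>y. nbr x y \<and> (\<exists>C. y \<in> C \<and> substantial_comp \<epsilon> d (hypercube d \<inter> level_set \<omega> d h) C))"

lemma near_substantial_iff:
  "near_substantial \<epsilon> d h x \<omega> \<longleftrightarrow>
    (\<exists>C\<in>{C. (\<exists>y\<in>C. nbr x y) \<and> substantial_comp \<epsilon> d (hypercube d) C}. \<forall>z\<in>C. h \<le> \<omega> z)"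
proof -
  have "substantial_comp \<epsilon> d (hypercube d \<inter> level_set \<omega> d h) C
      \<longleftrightarrow> substantial_comp \<epsilon> d (hypercube d) C \<and> (\<forall>z\<in>C. h \<le> \<omega> z)" for C
    using hypercube_subset_lattice[of d] by (auto simp: substantial_comp_def level_set_def)
  then show ?thesis by (auto simp: near_substantial_def)
qed

lemma (in gaussian_free_field) near_substantial_measurable:
  "{\<omega> \<in> space P. near_substantial \<epsilon> d h x \<omega>} \<in> events"
  unfolding near_substantial_iff
proof (intro sets.sets_Collect_finite_Ex)
  let ?\<C> = "{C. (\<exists>y\<in>C. nbr x y) \<and> substantial_comp \<epsilon> d (hypercube d) C}"
  show "finite ?\<C>"
    by (rule finite_subset[of _ "Pow (hypercube d)"])
      (auto simp: finite_hypercube substantial_comp_def)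
  fix C assume "C \<in> ?\<C>"
  then have "finite C"
    using finite_subset[OF _ finite_hypercube] by (auto simp: substantial_comp_def)
  then show "{\<omega> \<in> space P. \<forall>z\<in>C. h \<le> \<omega> z} \<in> events"
    by (intro sets.sets_Collect_finite_All borel_measurable_le borel_measurable_const
      coordinate_measurable)
qed

lemma near_substantial_if_blocks_occupied:
  assumes x: "x \<in> hypercube d" and size: "m * s * L \<le> d" and pos: "m > 0" "s > 0"
    and large: "real_of_int \<lfloor>real d powr \<epsilon> / bconst \<epsilon>\<rfloor> powr (bconst \<epsilon> - 1) \<le> real (s ^ m)"
    and occupied: "\<And>v b. v \<in> flip_ball d x m \<Longrightarrow> b < m * s \<Longrightarrow> \<exists>i\<in>block L b. h \<le> \<omega> (flip v i)"
  shows "near_substantial \<epsilon> d h x \<omega>"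
proof -
  have "\<exists>i\<in>block L b. flip v i \<in> hypercube d \<inter> level_set \<omega> d h"
    if v: "v \<in> flip_ball d x m" and b: "b < m * s" for v b
  proof -
    obtain i where i: "i \<in> block L b" "h \<le> \<omega> (flip v i)" using occupied[OF v b] by blast
    have "i < d" using i(1) block_subset[of 0 b "m * s" L] b size by force
    then have "flip v i \<in> hypercube d"
      using v flip_ball_subset_hypercube[OF x] by (blast intro: flip_in_hypercube)
    then show ?thesis using i hypercube_subset_lattice by (auto simp: level_set_def)
  qed
  from large_component_exists[OF x size pos this]
  obtain y C where yC: "nbr x y" "y \<in> C" "C \<subseteq> hypercube d \<inter> level_set \<omega> d h" "nn_connected C"
    "s ^ m \<le> card C" by blast
  have "real (s ^ m) \<le> real (card C)" using yC(5) by (simp only: of_nat_le_iff)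
  then have "substantial_comp \<epsilon> d (hypercube d \<inter> level_set \<omega> d h) C"
    using yC large unfolding substantial_comp_def by linarith
  then show ?thesis using yC by (auto simp: near_substantial_def)
qed

lemma (in gaussian_free_field) prob_near_substantial_ge:
  assumes x: "x \<in> hypercube d" and d: "d \<ge> 25" and h: "h \<ge> 0"
    and size: "m * s * L \<le> d" and pos: "m > 0" "s > 0" "L > 0"
    and large: "real_of_int \<lfloor>real d powr \<epsilon> / bconst \<epsilon>\<rfloor> powr (bconst \<epsilon> - 1) \<le> real (s ^ m)"
  shows "1 - real (Suc d ^ m * (m * s)) * vacancy_bound d L h
    \<le> prob {\<omega> \<in> space P. near_substantial \<epsilon> d h x \<omega>}"
    (is "1 - _ * ?p \<le> prob ?E")
proof -
  define I where "I = flip_ball d x m \<times> {..<m * s}"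
  define vacant where "vacant = (\<lambda>(v, b). {\<omega> \<in> space P. \<forall>i\<in>block L b. \<omega> (flip v i) < h})"
  have finite_I: "finite I" by (simp add: I_def finite_flip_ball)
  have card_I: "card I \<le> Suc d ^ m * (m * s)"
    using card_flip_ball_le[of d x m] by (simp add: I_def card_cartesian_product)
  have vacant_sets: "vacant p \<in> events" for p
    unfolding vacant_def split_beta by (intro sets.sets_Collect_finite_All) (auto simp: block_def)
  have vacant_le: "prob (vacant p) \<le> ?p" if p_in_I: "p \<in> I" for p
  proof -
    obtain v b where p: "p = (v, b)" "v \<in> flip_ball d x m" "b < m * s"
      using p_in_I by (cases p) (auto simp: I_def)
    have "block L b \<subseteq> {..<d}" using block_subset[of 0 b "m * s" L] p size by force
    moreover have "block L b \<noteq> {}" using pos by (simp add: block_def)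
    moreover have "v \<in> hypercube d" using p flip_ball_subset_hypercube[OF x] by blast
    ultimately show ?thesis
      using prob_all_flips_below[of v "block L b" h] d h by (simp add: p vacant_def)
  qed
  have "space P - ?E \<subseteq> (\<Union>p\<in>I. vacant p)"
  proof
    fix \<omega> assume \<omega>: "\<omega> \<in> space P - ?E"
    then have "\<not> (\<forall>v\<in>flip_ball d x m. \<forall>b<m * s. \<exists>i\<in>block L b. h \<le> \<omega> (flip v i))"
      using near_substantial_if_blocks_occupied[OF x size pos(1,2) large] by blast
    then show "\<omega> \<in> (\<Union>p\<in>I. vacant p)" using \<omega> by (auto simp: I_def vacant_def not_le)
  qed
  then have "prob (space P - ?E) \<le> prob (\<Union>p\<in>I. vacant p)"
    using finite_I vacant_sets by (intro finite_measure_mono) auto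
  also have "\<dots> \<le> (\<Sum>p\<in>I. prob (vacant p))"
    using finite_I vacant_sets by (intro measure_UNION_le) auto
  also have "\<dots> \<le> real (card I) * ?p"
    using vacant_le by (intro sum_bounded_above) auto
  also have "\<dots> \<le> real (Suc d ^ m * (m * s)) * ?p"
    using card_I
    by (intro mult_right_mono) (auto simp: vacancy_bound_def simp del: of_nat_mult of_nat_power)
  finally show ?thesis using prob_compl[OF near_substantial_measurable] by simp
qed

section \<open>Asymptotics in the dimension\<close>

definition depth :: "real \<Rightarrow> nat" where
  "depth \<epsilon> = nat \<lceil>11 / \<epsilon>\<rceil>"

definition branching :: "real \<Rightarrow> nat \<Rightarrow> nat" where
  "branching \<epsilon> d = nat \<lfloor>real d powr \<epsilon> / bconst \<epsilon>\<rfloor>"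

definition block_length :: "real \<Rightarrow> nat \<Rightarrow> nat" where
  "block_length \<epsilon> d = d div (depth \<epsilon> * branching \<epsilon> d)"

lemma depth_pos: "\<epsilon> > 0 \<Longrightarrow> depth \<epsilon> > 0"
  by (simp add: depth_def)

lemma bconst_ge_1: "\<epsilon> > 0 \<Longrightarrow> bconst \<epsilon> \<ge> 1"
  by (simp add: bconst_def)

lemma branching_le:
  assumes "\<epsilon> > 0"
  shows "real (branching \<epsilon> d) \<le> real d powr \<epsilon>"
proof -
  have "real (branching \<epsilon> d) \<le> real d powr \<epsilon> / bconst \<epsilon>"
    using bconst_ge_1[OF assms] by (simp add: branching_def of_nat_nat)
  also have "\<dots> \<le> real d powr \<epsilon>"
    using divide_left_mono[OF bconst_ge_1[OF assms], of "real d powr \<epsilon>"] bconst_ge_1[OF assms]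
    by simp
  finally show ?thesis .
qed

lemma substantial_size_le:
  assumes "\<epsilon> > 0" "branching \<epsilon> d > 0"
  shows "real_of_int \<lfloor>real d powr \<epsilon> / bconst \<epsilon>\<rfloor> powr (bconst \<epsilon> - 1)
    \<le> real (branching \<epsilon> d ^ depth \<epsilon>)"
proof -
  have "real_of_int \<lfloor>real d powr \<epsilon> / bconst \<epsilon>\<rfloor> = real (branching \<epsilon> d)"
    using assms by (simp add: branching_def)
  then have "real_of_int \<lfloor>real d powr \<epsilon> / bconst \<epsilon>\<rfloor> powr (bconst \<epsilon> - 1)
      = real (branching \<epsilon> d) powr (11 / \<epsilon>)" by (simp add: bconst_def)
  also have "\<dots> \<le> real (branching \<epsilon> d) powr real (depth \<epsilon>)"
    using assms by (intro powr_mono) (auto simp: depth_def, linarith?)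
  also have "\<dots> = real (branching \<epsilon> d ^ depth \<epsilon>)" using assms by (simp add: powr_realpow)
  finally show ?thesis .
qed

lemma block_length_ge:
  assumes "\<epsilon> > 0" "branching \<epsilon> d > 0"
  shows "real d powr (1 - \<epsilon>) / depth \<epsilon> - 1 \<le> real (block_length \<epsilon> d)"
proof -
  define n where "n = depth \<epsilon> * branching \<epsilon> d"
  have n: "n > 0" using assms depth_pos by (simp add: n_def)
  have "d > 0" using assms by (cases d) (auto simp: branching_def)
  have "real d powr (1 - \<epsilon>) / depth \<epsilon> = real d / (depth \<epsilon> * real d powr \<epsilon>)"
    using \<open>d > 0\<close> by (simp add: powr_diff)
  also have "\<dots> \<le> real d / real n"
    using branching_le[OF assms(1), of d] assms depth_pos[of \<epsilon>] \<open>d > 0\<close>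
    unfolding n_def of_nat_mult by (intro divide_left_mono mult_left_mono mult_pos_pos) auto
  also have "\<dots> \<le> real (block_length \<epsilon> d) + 1"
    unfolding block_length_def n_def[symmetric]
    using real_of_int_floor_add_one_ge[of "real d / real n"] by (simp add: floor_divide_of_nat_eq)
  finally show ?thesis by simp
qed

lemma eventually_branching_pos:
  assumes "\<epsilon> > 0"
  shows "\<forall>\<^sub>F d in sequentially. branching \<epsilon> d > 0"
proof -
  have "\<forall>\<^sub>F d in sequentially. bconst \<epsilon> \<le> real d powr \<epsilon>" using assms by real_asymp
  then show ?thesis
  proof eventually_elim
    case (elim d)
    then have "1 \<le> real d powr \<epsilon> / bconst \<epsilon>" using bconst_ge_1[OF assms] by simp
    then show ?case by (simp add: branching_def)
  qed
qed

lemma eventually_block_length_pos: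
  assumes "0 < \<epsilon>" "\<epsilon> < 1"
  shows "\<forall>\<^sub>F d in sequentially. block_length \<epsilon> d > 0"
proof -
  have "\<forall>\<^sub>F d in sequentially. 1 < real d powr (1 - \<epsilon>) / depth \<epsilon>"
    using assms depth_pos[of \<epsilon>] by real_asymp
  then show ?thesis using eventually_branching_pos[OF assms(1)]
  proof eventually_elim
    case (elim d)
    then show ?case using block_length_ge[of \<epsilon> d] assms by (cases "block_length \<epsilon> d") auto
  qed
qed

definition scaled_level :: "real \<Rightarrow> real \<Rightarrow> real" where
  "scaled_level \<beta> x = (sqrt (2 * (1 + 1 / (x - 1)) * ln x) * \<beta> + 1) / sqrt (1 - 1 / (x - 1))"

lemma scaled_level_asymp:
  assumes "\<beta> > 0"
  shows "((\<lambda>x. ((scaled_level \<beta> x + 1)\<^sup>2 / 2 + c) / ln x) \<longlongrightarrow> \<beta>\<^sup>2) at_top"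
proof -
  have "((\<lambda>x. ((scaled_level \<beta> x + 1)\<^sup>2 / 2 + c) / ln x) \<longlongrightarrow> (2 powr (1 / 2) * \<beta>)\<^sup>2 / 2) at_top"
    unfolding scaled_level_def using assms by real_asymp
  then show ?thesis by (simp add: power_mult_distrib powr_half_sqrt)
qed

lemma eventually_std_normal_tail_scaled_level_ge:
  assumes "\<beta> > 0" "\<beta>\<^sup>2 < \<delta>"
  shows "\<forall>\<^sub>F x in at_top. x powr - \<delta> \<le> std_normal_tail (scaled_level \<beta> x)"
proof -
  have "\<forall>\<^sub>F x in at_top. ((scaled_level \<beta> x + 1)\<^sup>2 / 2 + ln (sqrt (2 * pi))) / ln x < \<delta>"
    using scaled_level_asymp[OF assms(1)] assms(2) by (rule order_tendstoD)
  moreover have "\<forall>\<^sub>F x::real in at_top. x \<ge> 3" by (rule eventually_ge_at_top)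
  ultimately show ?thesis
  proof eventually_elim
    case (elim x)
    have "scaled_level \<beta> x \<ge> 0"
      unfolding scaled_level_def using elim assms
      by (intro divide_nonneg_nonneg add_nonneg_nonneg) auto
    have "(scaled_level \<beta> x + 1)\<^sup>2 / 2 + ln (sqrt (2 * pi)) \<le> \<delta> * ln x"
      using elim by (simp add: divide_less_eq)
    then have "x powr - \<delta> \<le> exp (- ((scaled_level \<beta> x + 1)\<^sup>2 / 2 + ln (sqrt (2 * pi))))"
      using elim by (simp add: powr_def)
    also have "\<dots> = exp (- (scaled_level \<beta> x + 1)\<^sup>2 / 2) / sqrt (2 * pi)"
      by (simp add: exp_diff exp_minus)
    also have "\<dots> \<le> std_normal_tail (scaled_level \<beta> x)"
      using \<open>scaled_level \<beta> x \<ge> 0\<close> by (rule std_normal_tail_ge)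
    finally show ?case .
  qed
qed

lemma h_as_bounds:
  assumes "d \<ge> 25"
  shows "0 \<le> h_as d" "h_as d \<le> sqrt (2 * (1 + 1 / (real d - 1)) * ln (real d))"
proof -
  have origin: "length (origin d) = d" by (simp add: origin_def)
  have g: "1 \<le> green (origin d) (origin d)" "green (origin d) (origin d) \<le> 1 + 1 / (real d - 1)"
    using green_diag_ge_1[OF origin assms] green_diag_le[OF origin assms] by auto
  have "ln (real d) \<ge> 0" using assms by simp
  then show "0 \<le> h_as d" "h_as d \<le> sqrt (2 * (1 + 1 / (real d - 1)) * ln (real d))"
    using g unfolding h_as_def by (auto intro!: mult_nonneg_nonneg mult_right_mono)
qed

lemma eventually_exceedance_bound_ge:
  assumes "\<beta> > 0" "\<beta>\<^sup>2 < \<delta>"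
  shows "\<forall>\<^sub>F d in sequentially. real d powr - \<delta> \<le> exceedance_bound d (h_as d * \<beta>)"
proof -
  have "\<forall>\<^sub>F d in sequentially. real d powr - \<delta> \<le> std_normal_tail (scaled_level \<beta> (real d))"
    using eventually_std_normal_tail_scaled_level_ge[OF assms] filterlim_real_sequentially
    by (rule eventually_compose_filterlim)
  then show ?thesis using eventually_ge_at_top[of 25]
  proof eventually_elim
    case (elim d)
    then have "(h_as d * \<beta> + 1) / sqrt (1 - 1 / (real d - 1)) \<le> scaled_level \<beta> (real d)"
      unfolding scaled_level_def using h_as_bounds[of d] assms
      by (intro divide_right_mono add_right_mono mult_right_mono) auto
    then have "std_normal_tail (scaled_level \<beta> (real d)) \<le> exceedance_bound d (h_as d * \<beta>)"
      unfolding exceedance_bound_def by (rule std_normal_tail_antimono)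
    with elim(1) show ?case by (rule order_trans)
  qed
qed

lemma eventually_block_exceedance_ge:
  assumes "\<epsilon> > 0" "\<beta> > 0" "\<beta>\<^sup>2 < \<delta>"
  shows "\<forall>\<^sub>F d in sequentially.
    real d powr (1 - \<epsilon> - \<delta>) / depth \<epsilon> - 1 \<le> block_length \<epsilon> d * exceedance_bound d (h_as d * \<beta>)"
  using eventually_exceedance_bound_ge[OF assms(2,3)] eventually_branching_pos[OF assms(1)]
    eventually_gt_at_top[of 0]
proof eventually_elim
  case (elim d)
  have "\<delta> \<ge> 0" using zero_le_power2[of \<beta>] assms(3) by linarith
  then have "real d powr - \<delta> \<le> real d powr 0" using elim by (intro powr_mono) auto
  moreover have "real d powr (1 - \<epsilon> - \<delta>) = real d powr (1 - \<epsilon>) * real d powr - \<delta>"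
    by (simp flip: powr_add)
  ultimately have "real d powr (1 - \<epsilon> - \<delta>) / depth \<epsilon> - 1
      \<le> (real d powr (1 - \<epsilon>) / depth \<epsilon> - 1) * real d powr - \<delta>"
    using elim by (simp add: algebra_simps)
  also have "\<dots> \<le> block_length \<epsilon> d * real d powr - \<delta>"
    using block_length_ge[OF assms(1)] elim by (intro mult_right_mono) auto
  also have "\<dots> \<le> block_length \<epsilon> d * exceedance_bound d (h_as d * \<beta>)"
    using elim by (intro mult_left_mono) auto
  finally show ?case .
qed

lemma eventually_union_bound_le:
  fixes \<epsilon> \<gamma> M :: real
  assumes "0 < \<epsilon>" "\<epsilon> < \<gamma>" "\<gamma> < 1" "M > 0"
  shows "\<forall>\<^sub>F x in at_top. (x + 1) powr M * (M * x powr \<epsilon>)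
    * (exp (- (x powr \<gamma> / M - 1)) + exp (- ((x - 1) / 2))) \<le> exp (- (x powr \<epsilon>))"
  using assms by real_asymp

lemma eventually_failure_bound_le:
  assumes \<epsilon>: "\<epsilon> > 0" and \<beta>: "\<beta> > 0" "\<beta>\<^sup>2 < 1 - 2 * \<epsilon>"
  shows "\<forall>\<^sub>F d in sequentially. real (Suc d ^ depth \<epsilon> * (depth \<epsilon> * branching \<epsilon> d))
    * vacancy_bound d (block_length \<epsilon> d) (h_as d * \<beta>) \<le> exp (- (real d powr \<epsilon>))"
proof -
  define M where "M = real (depth \<epsilon>)"
  have "M > 0" using \<epsilon> depth_pos by (simp add: M_def)
  obtain \<delta> where \<delta>: "\<beta>\<^sup>2 < \<delta>" "\<delta> < 1 - 2 * \<epsilon>" using dense[OF \<beta>(2)] by blast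
  define \<gamma> where "\<gamma> = 1 - \<epsilon> - \<delta>"
  have \<gamma>: "\<epsilon> < \<gamma>" "\<gamma> < 1"
    using \<delta> \<epsilon> zero_le_power2[of \<beta>] unfolding \<gamma>_def by linarith+
  have "\<forall>\<^sub>F d in sequentially. (real d + 1) powr M * (M * real d powr \<epsilon>)
      * (exp (- (real d powr \<gamma> / M - 1)) + exp (- ((real d - 1) / 2))) \<le> exp (- (real d powr \<epsilon>))"
    using eventually_union_bound_le[OF \<epsilon> \<gamma> \<open>M > 0\<close>] filterlim_real_sequentially
    by (rule eventually_compose_filterlim)
  moreover have "\<forall>\<^sub>F d in sequentially.
      real d powr \<gamma> / M - 1 \<le> block_length \<epsilon> d * exceedance_bound d (h_as d * \<beta>)"
    unfolding \<gamma>_def M_def using \<epsilon> \<beta>(1) \<delta>(1) by (rule eventually_block_exceedance_ge)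
  ultimately show ?thesis
  proof eventually_elim
    case (elim d)
    define D where "D = real (Suc d ^ depth \<epsilon> * (depth \<epsilon> * branching \<epsilon> d))"
    have "D = (real d + 1) powr M * (M * real (branching \<epsilon> d))"
      by (simp add: D_def M_def powr_realpow add.commute)
    also have "\<dots> \<le> (real d + 1) powr M * (M * real d powr \<epsilon>)"
      using branching_le[OF \<epsilon>] \<open>M > 0\<close> by (intro mult_left_mono) auto
    finally show ?case unfolding D_def[symmetric] vacancy_bound_def
      using elim \<open>M > 0\<close> by (intro order_trans[OF mult_mono elim(1)] add_right_mono) auto
  qed
qed

lemma eventually_near_substantial:
  assumes \<epsilon>: "0 < \<epsilon>" "\<epsilon> < 1/3"
  shows "\<forall>\<^sub>F d in sequentially. \<forall>x\<in>hypercube d. \<forall>P. gff_law d P \<longrightarrow> 1 - exp (- (real d powr \<epsilon>))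
    \<le> measure P {\<omega> \<in> space P. near_substantial \<epsilon> d (h_as d * (1 - 2 * \<epsilon>)) x \<omega>}"
proof -
  define \<beta> where "\<beta> = 1 - 2 * \<epsilon>"
  have \<beta>: "\<beta> > 0" and "\<epsilon> < 1" using \<epsilon> by (simp_all add: \<beta>_def)
  have "\<beta> * \<beta> < \<beta> * 1" using \<epsilon> \<beta> by (intro mult_strict_left_mono) (auto simp: \<beta>_def)
  then have "\<beta>\<^sup>2 < 1 - 2 * \<epsilon>" by (simp add: \<beta>_def power2_eq_square)
  from eventually_failure_bound_le[OF \<epsilon>(1) \<beta> this]
  have "\<forall>\<^sub>F d in sequentially. \<forall>x\<in>hypercube d. \<forall>P. gff_law d P \<longrightarrow> 1 - exp (- (real d powr \<epsilon>))
      \<le> measure P {\<omega> \<in> space P. near_substantial \<epsilon> d (h_as d * \<beta>) x \<omega>}"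
    using eventually_block_length_pos[OF \<epsilon>(1) \<open>\<epsilon> < 1\<close>] eventually_branching_pos[OF \<epsilon>(1)]
      eventually_ge_at_top[of 25]
  proof eventually_elim
    case (elim d)
    show ?case
    proof (intro ballI allI impI)
      fix x P assume x: "x \<in> hypercube d" and "gff_law d P"
      then interpret gaussian_free_field P d by (intro gaussian_free_fieldI)
      have "depth \<epsilon> * branching \<epsilon> d * block_length \<epsilon> d \<le> d"
        unfolding block_length_def by (rule times_div_less_eq_dividend)
      moreover have "h_as d * \<beta> \<ge> 0" using h_as_bounds[of d] elim \<beta> by simp
      moreover have "depth \<epsilon> > 0" "branching \<epsilon> d > 0" "block_length \<epsilon> d > 0"
        using \<epsilon> elim depth_pos by auto
      ultimately show "1 - exp (- (real d powr \<epsilon>))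
          \<le> prob {\<omega> \<in> space P. near_substantial \<epsilon> d (h_as d * \<beta>) x \<omega>}"
        using prob_near_substantial_ge[OF x, of "h_as d * \<beta>" "depth \<epsilon>" "branching \<epsilon> d" _ \<epsilon>]
          substantial_size_le[OF \<epsilon>(1), of d] elim by force
    qed
  qed
  then show ?thesis by (simp only: \<beta>_def)
qed

lemma one_minus_exp_le_uniform:
  fixes p \<epsilon> :: real
  assumes "0 \<le> \<epsilon>" "0 \<le> p" "d\<^sub>0 \<le> d \<Longrightarrow> 1 - exp (- (real d powr \<epsilon>)) \<le> p"
  shows "1 - exp (real d\<^sub>0 powr \<epsilon>) * exp (- (real d powr \<epsilon>)) \<le> p"
proof (cases "d\<^sub>0 \<le> d")
  case True
  have "1 * exp (- (real d powr \<epsilon>)) \<le> exp (real d\<^sub>0 powr \<epsilon>) * exp (- (real d powr \<epsilon>))"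
    by (intro mult_right_mono) auto
  then show ?thesis using assms(3)[OF True] by linarith
next
  case False
  then have "real d powr \<epsilon> \<le> real d\<^sub>0 powr \<epsilon>" using assms by (intro powr_mono2) auto
  then have "1 \<le> exp (real d\<^sub>0 powr \<epsilon>) * exp (- (real d powr \<epsilon>))" by (simp flip: exp_add)
  then show ?thesis using \<open>0 \<le> p\<close> by linarith
qed

theorem theorem4p4:
  fixes \<epsilon> :: real
  assumes "0 < \<epsilon>" and "\<epsilon> < 1/3"
  shows "\<exists>c c'. c > 0 \<and> c' > 0 \<and>
    (\<forall>d::nat. d \<ge> 3 \<longrightarrow> (\<forall>x \<in> hypercube d. \<forall>P. gff_law d P \<longrightarrow>
      measure P {\<omega> \<in> space P. \<exists>y. nbr x y \<and>
          (\<exists>C. y \<in> C \<and> substantial_comp \<epsilon> d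
                 (hypercube d \<inter> level_set \<omega> d (h_as d * (1 - 2 * \<epsilon>))) C)}
        \<ge> 1 - c * exp (- c' * real d powr \<epsilon>)))"
proof -
  obtain d\<^sub>0 where d\<^sub>0: "\<And>d x P. d\<^sub>0 \<le> d \<Longrightarrow> x \<in> hypercube d \<Longrightarrow> gff_law d P \<Longrightarrow>
      1 - exp (- (real d powr \<epsilon>))
        \<le> measure P {\<omega> \<in> space P. near_substantial \<epsilon> d (h_as d * (1 - 2 * \<epsilon>)) x \<omega>}"
    using eventually_near_substantial[OF assms] unfolding eventually_sequentially by blast
  have "1 - exp (real d\<^sub>0 powr \<epsilon>) * exp (- 1 * real d powr \<epsilon>)
      \<le> measure P {\<omega> \<in> space P. near_substantial \<epsilon> d (h_as d * (1 - 2 * \<epsilon>)) x \<omega>}"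
    if "x \<in> hypercube d" "gff_law d P" for d x P
    using one_minus_exp_le_uniform[OF _ measure_nonneg d\<^sub>0[OF _ that]] assms(1) by simp
  then show ?thesis unfolding near_substantial_def
    by (intro exI[of _ "exp (real d\<^sub>0 powr \<epsilon>)"] exI[of _ 1]) simp
qed

end
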